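(* Let $\overline{\mathrm{Q}}$ be any imprecise probability tree. There is a unique most conservative (i.e. pointwise largest) upper expectation $\overline{\mathrm{E}}_{\mathrm{A}}$ in $\overline{\mathbb{E}}_{1-5}(\overline{\mathrm{Q}})$, and it is the global game-theoretic upper expectation $\overline{\mathrm{E}}_{\mathrm{V}}$. That is, $\overline{\mathrm{E}}_{\mathrm{V}}\in\overline{\mathbb{E}}_{1-5}(\overline{\mathrm{Q}})$ and $\overline{\mathrm{E}}'(f\vert s)\leq\overline{\mathrm{E}}_{\mathrm{V}}(f\vert s)$ for all $\overline{\mathrm{E}}'\in\overline{\mathbb{E}}_{1-5}(\overline{\mathrm{Q}})$, all $f\in\overline{\mathbb{V}}$ and all $s\in\mathscr{X}^*$. Furthermore, if an upper expectation $\overline{\mathrm{E}}$ in $\overline{\mathbb{E}}_{1-5}(\overline{\mathrm{Q}})$ satisfies P3$^{=}$, P6 and P7, then it is equal to this most conservative upper expectation $\overline{\mathrm{E}}_{\mathrm{A}}$, and therefore also equal to $\overline{\mathrm{E}}_{\mathrm{V}}$.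
   Context: Conventions: $\mathbb{N}=\{1,2,\dots\}$, $\mathbb{N}_0=\mathbb{N}\cup\{0\}$, $\overline{\mathbb{R}}=\mathbb{R}\cup\{-\infty,+\infty\}$, with $+\infty-\infty=-\infty+\infty=+\infty$ and $0\cdot(+\infty)=0\cdot(-\infty)=0$; $\inf\emptyset=+\infty$. Inequalities between functions and limits of functions are pointwise. Setting: $\mathscr{X}$ is a finite non-empty set (state space). A situation is a finite string $x_{1:n}=(x_1,\dots,x_n)\in\mathscr{X}^n$, $n\in\mathbb{N}_0$ (the empty string is denoted $\Box$); $\mathscr{X}^*$ is the set of all situations. $\Omega=\mathscr{X}^{\mathbb{N}}$ is the set of paths $\omega=\omega_1\omega_2\cdots$, and $\omega^n=(\omega_1,\dots,\omega_n)$. For $s=x_{1:n}$, $\Gamma(s)=\{\omega\in\Omega:\omega^n=x_{1:n}\}$ and $\mathbb{I}_s$ is the indicator of $\Gamma(s)$. $\overline{\mathbb{V}}$ is the set of all maps $\Omega\to\overline{\mathbb{R}}$ (global variables) and $\overline{\mathbb{V}}_{\mathrm b}$ the set of those that are bounded below by a real. A gamble is a bounded real-valued function. $f\in\overline{\mathbb{V}}$ is $n$-measurable if $f(\omega)$ depends only on $\omega^n$; it is finitary if it is $n$-measurable for some $n\in\mathbb{N}_0$. $\mathbb{V}_{\mathrm{fin}}$ is the set of finitary gambles on $\Omega$. $\overline{\mathbb{V}}_{\mathrm{b,lim}}$ is the set of all $f\in\overline{\mathbb{V}}_{\mathrm b}$ that are the pointwise limit of some sequence in $\mathbb{V}_{\mathrm{fin}}$.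 A sequence $\{f_n\}$ is uniformly bounded below if there is a real $c$ with $f_n\geq c$ for all $n$. $\mathscr{L}(\mathscr{X})$ is the set of all real-valued functions on $\mathscr{X}$; for $f\in\mathscr{L}(\mathscr{X})$, $f(X_{n+1})$ is the global variable $\omega\mapsto f(\omega_{n+1})$. Local models: an upper expectation $\overline{\mathrm{Q}}_s:\mathscr{L}(\mathscr{X})\to\overline{\mathbb{R}}$ is coherent if, for all $f,g\in\mathscr{L}(\mathscr{X})$ and real $\lambda\geq0$: $\overline{\mathrm{Q}}_s(f)\leq\sup f$; $\overline{\mathrm{Q}}_s(f+g)\leq\overline{\mathrm{Q}}_s(f)+\overline{\mathrm{Q}}_s(g)$; $\overline{\mathrm{Q}}_s(\lambda f)=\lambda\overline{\mathrm{Q}}_s(f)$ (it is then real-valued). An imprecise probability tree $\overline{\mathrm{Q}}$ assigns to each $s\in\mathscr{X}^*$ a coherent upper expectation $\overline{\mathrm{Q}}_s$ on $\mathscr{L}(\mathscr{X})$. A global upper expectation is any map $\overline{\mathrm{E}}:\overline{\mathbb{V}}\times\mathscr{X}^*\to\overline{\mathbb{R}}$, $(f,s)\mapsto\overline{\mathrm{E}}(f\vert s)$; $\overline{\mathrm{E}}(f\vert X_{1:n})$ denotes the global variable $\omega\mapsto\overline{\mathrm{E}}(f\vert\omega^n)$. Axioms: P1: $\overline{\mathrm{E}}(f(X_{n+1})\vert x_{1:n})=\overline{\mathrm{Q}}_{x_{1:n}}(f)$ for all $f\in\mathscr{L}(\mathscr{X})$, $x_{1:n}\in\mathscr{X}^*$.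 P2: $\overline{\mathrm{E}}(f\vert s)=\overline{\mathrm{E}}(f\,\mathbb{I}_s\vert s)$ for all $f\in\mathbb{V}_{\mathrm{fin}}$, $s\in\mathscr{X}^*$. P3: $\overline{\mathrm{E}}(f\vert X_{1:n})\leq\overline{\mathrm{E}}(\overline{\mathrm{E}}(f\vert X_{1:n+1})\vert X_{1:n})$ for all $f\in\mathbb{V}_{\mathrm{fin}}$, $n\in\mathbb{N}_0$. P4: $f\leq g\Rightarrow\overline{\mathrm{E}}(f\vert s)\leq\overline{\mathrm{E}}(g\vert s)$ for all $f,g\in\overline{\mathbb{V}}$, $s\in\mathscr{X}^*$. P5: for any sequence $\{f_n\}_{n\in\mathbb{N}_0}$ of finitary gambles that is uniformly bounded below and any $s\in\mathscr{X}^*$, if $\lim_{n}f_n=f$ pointwise then $\limsup_{n}\overline{\mathrm{E}}(f_n\vert s)\geq\overline{\mathrm{E}}(f\vert s)$. $\overline{\mathbb{E}}_{1-5}(\overline{\mathrm{Q}})$ is the set of all global upper expectations satisfying P1–P5. P3$^{=}$: $\overline{\mathrm{E}}(f\vert X_{1:n})=\overline{\mathrm{E}}(\overline{\mathrm{E}}(f\vert X_{1:n+1})\vert X_{1:n})$ for all $f\in\mathbb{V}_{\mathrm{fin}}$, $n\in\mathbb{N}_0$. P6: for any $f\in\overline{\mathbb{V}}_{\mathrm{b,lim}}$ and $s\in\mathscr{X}^*$ there is a sequence $\{f_n\}_{n\in\mathbb{N}_0}$ of gambles, with each $f_n$ $n$-measurable, that is uniformly bounded below, converges pointwise to $f$,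 and satisfies $\limsup_n\overline{\mathrm{E}}(f_n\vert s)\leq\overline{\mathrm{E}}(f\vert s)$. P7: $\overline{\mathrm{E}}(f\vert s)=\inf\{\overline{\mathrm{E}}(g\vert s):g\in\overline{\mathbb{V}}_{\mathrm{b,lim}},\ g\geq f\}$ for all $f\in\overline{\mathbb{V}}$, $s\in\mathscr{X}^*$. Extended local models: for each $s$, $\overline{\mathrm{Q}}{}_s^{\uparrow}$ is the unique extension of $\overline{\mathrm{Q}}_s$ to all functions $f:\mathscr{X}\to\overline{\mathbb{R}}$ satisfying $\overline{\mathrm{Q}}{}_s^{\uparrow}(f)=\lim_{c\to+\infty}\overline{\mathrm{Q}}{}_s^{\uparrow}(\min\{f,c\})$ for all bounded below $f$, and $\overline{\mathrm{Q}}{}_s^{\uparrow}(f)=\lim_{c\to-\infty}\overline{\mathrm{Q}}{}_s^{\uparrow}(\max\{f,c\})$ for all $f$. Game-theoretic upper expectation: a supermartingale is a map $\mathscr{M}:\mathscr{X}^*\to\overline{\mathbb{R}}$ with $\overline{\mathrm{Q}}{}_s^{\uparrow}(\mathscr{M}(s\,\cdot))\leq\mathscr{M}(s)$ for all $s\in\mathscr{X}^*$, where $\mathscr{M}(s\,\cdot)$ is the function $x\mapsto\mathscr{M}(sx)$ on $\mathscr{X}$. $\overline{\mathbb{M}}_{\mathrm b}$ is the set of supermartingales that are bounded below by a real constant. $\liminf\mathscr{M}$ is the global variable $\omega\mapsto\liminf_{n\to+\infty}\mathscr{M}(\omega^n)$, and $f\geq_s g$ means $f(\omega)\geq g(\omega)$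 for all $\omega\in\Gamma(s)$. Then $\overline{\mathrm{E}}_{\mathrm V}(f\vert s)=\inf\{\mathscr{M}(s):\mathscr{M}\in\overline{\mathbb{M}}_{\mathrm b},\ \liminf\mathscr{M}\geq_s f\}$ for all $f\in\overline{\mathbb{V}}$, $s\in\mathscr{X}^*$. *)

theory Defs
  imports Complex_Main "HOL-Library.Extended_Real" "HOL-Library.Indicator_Function"
begin

text \<open>
  The state space is the universe of a type \<open>'x :: finite\<close> (finite and non-empty).
  Situations are lists, and a path is a map \<open>\<omega> :: nat \<Rightarrow> 'x\<close> in which \<open>\<omega> n\<close> is the
  state at time \<open>n + 1\<close>. Type \<^typ>\<open>ereal\<close> has the required conventions:
  \<open>\<infinity> + (- \<infinity>) = - \<infinity> + \<infinity> = \<infinity>\<close>, \<open>0 * \<infinity> = 0 * (- \<infinity>) = 0\<close> and \<open>Inf {} = \<infinity>\<close>.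
\<close>

type_synonym 'x path = "nat \<Rightarrow> 'x"
type_synonym 'x gvar = "'x path \<Rightarrow> ereal"
type_synonym 'x local_model = "('x \<Rightarrow> real) \<Rightarrow> ereal"
type_synonym 'x tree = "'x list \<Rightarrow> 'x local_model"
type_synonym 'x global_expectation = "'x gvar \<Rightarrow> 'x list \<Rightarrow> ereal"

definition path_prefix :: "nat \<Rightarrow> 'x path \<Rightarrow> 'x list" where
  "path_prefix n \<omega> = map \<omega> [0..<n]"

definition cylinder :: "'x list \<Rightarrow> 'x path set" where
  "cylinder s = {\<omega>. path_prefix (length s) \<omega> = s}"


definition bounded_below :: "('a \<Rightarrow> ereal) \<Rightarrow> bool" where
  "bounded_below f \<longleftrightarrow> (\<exists>c::real. \<forall>a. ereal c \<le> f a)"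

definition uniformly_bounded_below :: "(nat \<Rightarrow> 'a \<Rightarrow> ereal) \<Rightarrow> bool" where
  "uniformly_bounded_below F \<longleftrightarrow> (\<exists>c::real. \<forall>n a. ereal c \<le> F n a)"

definition gamble :: "('a \<Rightarrow> ereal) \<Rightarrow> bool" where
  "gamble f \<longleftrightarrow> (\<exists>B::real. \<forall>a. \<bar>f a\<bar> \<le> ereal B)"

definition n_measurable :: "nat \<Rightarrow> 'x gvar \<Rightarrow> bool" where
  "n_measurable n f \<longleftrightarrow>
     (\<forall>\<omega> \<omega>'. path_prefix n \<omega> = path_prefix n \<omega>' \<longrightarrow> f \<omega> = f \<omega>')"

definition pointwise_limit :: "(nat \<Rightarrow> 'a \<Rightarrow> ereal) \<Rightarrow> ('a \<Rightarrow> ereal) \<Rightarrow> bool" where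
  "pointwise_limit F f \<longleftrightarrow> (\<forall>a. (\<lambda>n. F n a) \<longlonglongrightarrow> f a)"

definition V_fin :: "'x gvar set" where
  "V_fin = {f. gamble f \<and> (\<exists>n. n_measurable n f)}"

definition V_blim :: "'x gvar set" where
  "V_blim = {f. bounded_below f \<and> (\<exists>F. (\<forall>n. F n \<in> V_fin) \<and> pointwise_limit F f)}"


definition coherent :: "('x::finite) local_model \<Rightarrow> bool" where
  "coherent Q \<longleftrightarrow>
     (\<forall>f. Q f \<le> (SUP x. ereal (f x))) \<and>
     (\<forall>f g. Q (\<lambda>x. f x + g x) \<le> Q f + Q g) \<and>
     (\<forall>f (l::real). 0 \<le> l \<longrightarrow> Q (\<lambda>x. l * f x) = ereal l * Q f)"

definition imprecise_tree :: "('x::finite) tree \<Rightarrow> bool" where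
  "imprecise_tree Q \<longleftrightarrow> (\<forall>s. coherent (Q s))"

definition is_extension :: "('x::finite) local_model \<Rightarrow> (('x \<Rightarrow> ereal) \<Rightarrow> ereal) \<Rightarrow> bool" where
  "is_extension Q R \<longleftrightarrow>
     (\<forall>f. R (\<lambda>x. ereal (f x)) = Q f) \<and>
     (\<forall>f. bounded_below f \<longrightarrow> ((\<lambda>c::real. R (\<lambda>x. min (f x) (ereal c))) \<longlongrightarrow> R f) at_top) \<and>
     (\<forall>f. ((\<lambda>c::real. R (\<lambda>x. max (f x) (ereal c))) \<longlongrightarrow> R f) at_bot)"

text \<open>Well defined for coherent \<open>Q\<close>: see \<open>is_extension_ex1\<close> below.\<close>

definition extended :: "('x::finite) local_model \<Rightarrow> ('x \<Rightarrow> ereal) \<Rightarrow> ereal" where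
  "extended Q = (THE R. is_extension Q R)"

lemma coherent_mono:
  fixes Q :: "('x::finite) local_model"
  assumes "coherent Q" and "\<And>x. f x \<le> g x"
  shows "Q f \<le> Q g"
proof -
  have "Q (\<lambda>x. (f x - g x) + g x) \<le> Q (\<lambda>x. f x - g x) + Q g"
    using conjunct1[OF conjunct2[OF assms(1)[unfolded coherent_def]], rule_format, of "\<lambda>x. f x - g x" g] .
  moreover have "Q (\<lambda>x. f x - g x) \<le> (SUP x. ereal (f x - g x))"
    using assms(1) unfolding coherent_def by blast
  moreover have "(SUP x. ereal (f x - g x)) \<le> 0"
    by (rule SUP_least) (simp add: assms(2))
  ultimately show ?thesis
    using add_right_mono[of "Q (\<lambda>x. f x - g x)" 0 "Q g"] by (simp, meson order_trans)
qed

lemma tendsto_SUP_real: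
  fixes g :: "real \<Rightarrow> ereal"
  assumes "mono g"
  shows "(g \<longlongrightarrow> (SUP c. g c)) at_top"
proof (rule order_tendstoI)
  fix a assume "a < (SUP c. g c)"
  then obtain c where "a < g c" by (auto simp: less_SUP_iff)
  then show "\<forall>\<^sub>F x in at_top. a < g x"
    unfolding eventually_at_top_linorder using assms by (meson less_le_trans monoD)
next
  fix a assume "(SUP c. g c) < a"
  then show "\<forall>\<^sub>F x in at_top. g x < a"
    by (auto intro!: always_eventually intro: le_less_trans[OF SUP_upper])
qed

lemma tendsto_INF_real:
  fixes g :: "real \<Rightarrow> ereal"
  assumes "mono g"
  shows "(g \<longlongrightarrow> (INF c. g c)) at_bot"
proof (rule order_tendstoI)
  fix a assume "(INF c. g c) < a"
  then obtain c where "g c < a" by (auto simp: INF_less_iff)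
  then show "\<forall>\<^sub>F x in at_bot. g x < a"
    unfolding eventually_at_bot_linorder using assms by (meson le_less_trans monoD)
next
  fix a assume "a < (INF c. g c)"
  then show "\<forall>\<^sub>F x in at_bot. a < g x"
    by (auto intro!: always_eventually intro: less_le_trans[OF _ INF_lower])
qed

lemma real_min_ereal:
  assumes "ereal b \<le> u"
  shows "ereal (real_of_ereal (min u (ereal c))) = min u (ereal c)"
  using assms by (cases u) (auto simp: min_def)

lemma is_extension_unique:
  fixes Q :: "('x::finite) local_model"
  assumes R: "is_extension Q R" and S: "is_extension Q S"
  shows "R = S"
proof
  have bb: "R f = S f" if f: "bounded_below f" for f
  proof -
    obtain b where b: "\<And>x. ereal b \<le> f x" using f unfolding bounded_below_def by auto
    have "R (\<lambda>x. min (f x) (ereal c)) = S (\<lambda>x. min (f x) (ereal c))" for c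
    proof -
      have "(\<lambda>x. min (f x) (ereal c)) = (\<lambda>x. ereal (real_of_ereal (min (f x) (ereal c))))"
        by (simp add: real_min_ereal[OF b])
      moreover have "R (\<lambda>x. ereal (g x)) = S (\<lambda>x. ereal (g x))" for g
        using R S unfolding is_extension_def by simp
      ultimately show ?thesis by metis
    qed
    then show ?thesis
      using R S f unfolding is_extension_def
      by (auto intro: tendsto_unique[OF trivial_limit_at_top_linorder])
  qed
  fix f
  have "R (\<lambda>x. max (f x) (ereal c)) = S (\<lambda>x. max (f x) (ereal c))" for c
    by (rule bb) (unfold bounded_below_def, rule exI[of _ c], simp)
  then show "R f = S f"
    using R S unfolding is_extension_def
    by (auto intro: tendsto_unique[OF trivial_limit_at_bot_linorder])
qed

lemma is_extension_exists:
  fixes Q :: "('x::finite) local_model"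
  assumes Q: "coherent Q"
  shows "\<exists>R. is_extension Q R"
proof -
  define T where "T f d = Q (\<lambda>x. real_of_ereal (min (f x) (ereal d)))" for f :: "'x \<Rightarrow> ereal" and d
  define U where "U f = (SUP d. T f d)" for f
  define R where "R f = (INF c::real. U (\<lambda>x. max (f x) (ereal c)))" for f
  have Tmono: "T f d \<le> T g e" if f: "bounded_below f" and le: "\<And>x. f x \<le> g x" "d \<le> e" for f g d e
  proof -
    obtain b where b: "\<And>x. ereal b \<le> f x" using f unfolding bounded_below_def by auto
    have "real_of_ereal (min (f x) (ereal d)) \<le> real_of_ereal (min (g x) (ereal e))" for x
    proof -
      have "ereal b \<le> g x" using b le(1) order_trans by blast
      moreover have "min (f x) (ereal d) \<le> min (g x) (ereal e)"
        using le by (intro min.mono) auto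
      ultimately show ?thesis by (metis b ereal_less_eq(3) real_min_ereal)
    qed
    then show ?thesis unfolding T_def by (intro coherent_mono[OF Q])
  qed
  have Umono: "U f \<le> U g" if "bounded_below f" "\<And>x. f x \<le> g x" for f g
    unfolding U_def by (rule SUP_mono) (use Tmono[OF that] in blast)
  have RU: "R f = U f" if f: "bounded_below f" for f
  proof (rule antisym)
    obtain b where b: "\<And>x. ereal b \<le> f x" using f unfolding bounded_below_def by auto
    have "R f \<le> U (\<lambda>x. max (f x) (ereal b))" unfolding R_def by (rule INF_lower) simp
    also have "(\<lambda>x. max (f x) (ereal b)) = f" using b by (simp add: max_absorb1)
    finally show "R f \<le> U f" .
    show "U f \<le> R f" unfolding R_def by (rule INF_greatest) (rule Umono[OF f], simp)
  qed
  have Umin: "U (\<lambda>x. min (f x) (ereal c)) = T f c" if "bounded_below f" for f c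
  proof (rule antisym)
    have e: "T (\<lambda>x. min (f x) (ereal c)) d = T f (min c d)" for d
      unfolding T_def by (simp add: min.assoc flip: ereal_min)
    show "U (\<lambda>x. min (f x) (ereal c)) \<le> T f c"
      unfolding U_def e by (rule SUP_least) (rule Tmono[OF that], auto)
    show "T f c \<le> U (\<lambda>x. min (f x) (ereal c))"
      unfolding U_def e by (rule SUP_upper2[of c]) auto
  qed
  have 1: "R (\<lambda>x. ereal (f x)) = Q f" for f
  proof -
    have bb: "bounded_below (\<lambda>x. ereal (f x))"
      unfolding bounded_below_def by (rule exI[of _ "Min (range f)"]) auto
    have m: "(\<lambda>x. min (ereal (f x)) (ereal (Max (range f)))) = (\<lambda>x. ereal (f x))"
      by (rule ext) (simp add: min_absorb1)
    have "R (\<lambda>x. ereal (f x)) = T (\<lambda>x. ereal (f x)) (Max (range f))"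
      using Umin[OF bb, of "Max (range f)"] unfolding RU[OF bb] m .
    also have "\<dots> = Q f" unfolding T_def by (simp only: m fun_cong[OF m] real_of_ereal.simps)
    finally show ?thesis .
  qed
  have 2: "((\<lambda>c::real. R (\<lambda>x. min (f x) (ereal c))) \<longlongrightarrow> R f) at_top"
    if f: "bounded_below f" for f
  proof -
    obtain b where b: "\<And>x. ereal b \<le> f x" using f unfolding bounded_below_def by auto
    have "bounded_below (\<lambda>x. min (f x) (ereal c))" for c
      unfolding bounded_below_def
      by (rule exI[of _ "min b c"]) (use b in \<open>auto intro: order_trans[of _ "ereal b"]\<close>)
    then have "R (\<lambda>x. min (f x) (ereal c)) = T f c" for c using RU Umin[OF f] by simp
    moreover have "(T f \<longlongrightarrow> (SUP c. T f c)) at_top"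
      by (intro tendsto_SUP_real monoI Tmono[OF f]) auto
    ultimately show ?thesis unfolding RU[OF f] U_def by simp
  qed
  have 3: "((\<lambda>c::real. R (\<lambda>x. max (f x) (ereal c))) \<longlongrightarrow> R f) at_bot" for f
  proof -
    have bb: "bounded_below (\<lambda>x. max (f x) (ereal c))" for c
      unfolding bounded_below_def by (rule exI[of _ c]) simp
    have "mono (\<lambda>c. U (\<lambda>x. max (f x) (ereal c)))"
      by (intro monoI Umono[OF bb] max.mono) auto
    from tendsto_INF_real[OF this] show ?thesis by (simp add: RU[OF bb] flip: R_def)
  qed
  show ?thesis using 1 2 3 unfolding is_extension_def by blast
qed

lemma is_extension_ex1:
  fixes Q :: "('x::finite) local_model"
  assumes "coherent Q"
  shows "\<exists>!R. is_extension Q R"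
  using is_extension_exists[OF assms] is_extension_unique by blast


definition P1 :: "'x tree \<Rightarrow> 'x global_expectation \<Rightarrow> bool" where
  "P1 Q E \<longleftrightarrow> (\<forall>f s. E (\<lambda>\<omega>. ereal (f (\<omega> (length s)))) s = Q s f)"

definition P2 :: "'x global_expectation \<Rightarrow> bool" where
  "P2 E \<longleftrightarrow> (\<forall>f\<in>V_fin. \<forall>s. E f s = E (\<lambda>\<omega>. f \<omega> * indicator (cylinder s) \<omega>) s)"

definition P3 :: "'x global_expectation \<Rightarrow> bool" where
  "P3 E \<longleftrightarrow> (\<forall>f\<in>V_fin. \<forall>n \<omega>.
     E f (path_prefix n \<omega>) \<le> E (\<lambda>\<omega>'. E f (path_prefix (n + 1) \<omega>')) (path_prefix n \<omega>))"

definition P3_eq :: "'x global_expectation \<Rightarrow> bool" where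
  "P3_eq E \<longleftrightarrow> (\<forall>f\<in>V_fin. \<forall>n \<omega>.
     E f (path_prefix n \<omega>) = E (\<lambda>\<omega>'. E f (path_prefix (n + 1) \<omega>')) (path_prefix n \<omega>))"

definition P4 :: "'x global_expectation \<Rightarrow> bool" where
  "P4 E \<longleftrightarrow> (\<forall>f g. (\<forall>\<omega>. f \<omega> \<le> g \<omega>) \<longrightarrow> (\<forall>s. E f s \<le> E g s))"

definition P5 :: "'x global_expectation \<Rightarrow> bool" where
  "P5 E \<longleftrightarrow> (\<forall>F f s. (\<forall>n. F n \<in> V_fin) \<and> uniformly_bounded_below F \<and> pointwise_limit F f \<longrightarrow>
     E f s \<le> limsup (\<lambda>n. E (F n) s))"

definition P6 :: "'x global_expectation \<Rightarrow> bool" where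
  "P6 E \<longleftrightarrow> (\<forall>f\<in>V_blim. \<forall>s. \<exists>F. (\<forall>n. gamble (F n) \<and> n_measurable n (F n)) \<and>
     uniformly_bounded_below F \<and> pointwise_limit F f \<and> limsup (\<lambda>n. E (F n) s) \<le> E f s)"

definition P7 :: "'x global_expectation \<Rightarrow> bool" where
  "P7 E \<longleftrightarrow> (\<forall>f s. E f s = Inf {E g s |g. g \<in> V_blim \<and> (\<forall>\<omega>. f \<omega> \<le> g \<omega>)})"

definition E15 :: "'x tree \<Rightarrow> 'x global_expectation set" where
  "E15 Q = {E. P1 Q E \<and> P2 E \<and> P3 E \<and> P4 E \<and> P5 E}"

definition most_conservative :: "'x global_expectation set \<Rightarrow> 'x global_expectation \<Rightarrow> bool" where
  "most_conservative \<E> E \<longleftrightarrow> E \<in> \<E> \<and> (\<forall>E'\<in>\<E>. \<forall>f s. E' f s \<le> E f s)"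


definition supermartingale :: "('x::finite) tree \<Rightarrow> ('x list \<Rightarrow> ereal) \<Rightarrow> bool" where
  "supermartingale Q M \<longleftrightarrow> (\<forall>s. extended (Q s) (\<lambda>x. M (s @ [x])) \<le> M s)"

definition E_V :: "('x::finite) tree \<Rightarrow> 'x global_expectation" where
  "E_V Q f s = Inf {M s |M. supermartingale Q M \<and> bounded_below M \<and>
     (\<forall>\<omega>\<in>cylinder s. f \<omega> \<le> liminf (\<lambda>n. M (path_prefix n \<omega>)))}"

end

theory Submission
  imports Defs "HOL-Library.Countable"
begin

text \<open>
  On finitary gambles the largest possible expectation is explicit: P1--P4 bound every expectation from
  above by backward recursion through the local models, and \<open>E_V\<close> attains this bound
  (\<open>finitary_martingale\<close>, \<open>E_V_finitary\<close>, \<open>expectation_finitary_le_E_V\<close>). The passage from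
  finitary gambles to arbitrary variables goes through P5, a Fatou-type inequality along
  \<^emph>\<open>pointwise convergent\<close> sequences. Both halves of the theorem therefore come down to repairing
  failures of convergence at arbitrarily small cost, and one device does this in both cases.

  The device is Doob's upcrossing strategy (\<open>upcrossing_process\<close>). Given supermartingales bounded
  below by a common constant, a trader waits until one of them drops to a level \<open>a\<close>, holds it until
  it reaches a level \<open>b > a\<close>, and starts afresh. Its capital is a supermartingale \<open>Y\<close> that dominates
  a nondecreasing process \<open>V\<close> proportional to the number of completed upcrossings. Adding the capitals
  for all rational pairs of levels with weights \<open>\<epsilon> / 2 ^ Suc i\<close> costs at most \<open>\<epsilon>\<close>, and the sum tends to
  infinity on every path on which some pair of levels is crossed infinitely often.

  \<^item> \<open>E_V\<close> satisfies P5 (\<open>E_V_P5\<close>). Let \<open>F n \<longlonglongrightarrow> f\<close>. The infima over \<open>k\<close> of the expectations of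
    \<open>min {F n, \<dots>, F (n + k)}\<close> form a supermartingale \<open>e n\<close>, increasing in \<open>n\<close>, whose value in \<open>s\<close> stays
    below \<open>limsup (E_V (F n) s)\<close>. On a path where the limit inferior of \<open>sup e n\<close> over time falls short of
    \<open>f\<close>, there are \<open>n\<close> and rationals \<open>a < b\<close> such that \<open>e n < a\<close> infinitely often, while all the minima
    starting at \<open>n\<close> take a value above \<open>b\<close>. A trader who buys the expectation of such a minimum
    whenever it is available below \<open>a\<close> becomes infinitely rich there. So \<open>sup e n\<close> plus the weighted
    capitals is a supermartingale that certifies the bound.

  \<^item> Every \<open>E\<close> satisfying the axioms lies below \<open>E_V\<close> (\<open>expectation_le_E_V\<close>). Let \<open>M\<close> be a supermartingale
    with \<open>f \<le> liminf M\<close>. The finitary gambles \<open>min (M n) n + (weighted V)\<close> converge on every path: if \<open>M\<close>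
    converges, because \<open>V\<close> is monotone; if not, because some \<open>V\<close> tends to infinity. Their limit is at
    least \<open>f\<close> and their expectations are at most \<open>M s + \<epsilon>\<close>, hence P5 for \<open>E\<close> gives \<open>E f s \<le> M s + \<epsilon>\<close>.
    Using the monotone \<open>V\<close> in place of the capitals \<open>Y\<close>, which may oscillate, is what makes the
    sequence converge.

  The last claim is then short: with equality in P3 the expectation agrees with \<open>E_V\<close> on finitary
  gambles, P6 together with P5 for \<open>E_V\<close> carries \<open>E_V \<le> E\<close> over to limits of finitary gambles, and P7
  carries it to all variables.
\<close>

section \<open>Coherent local models and their extensions\<close>

lemma coherent_le_SUP: "coherent Q \<Longrightarrow> Q f \<le> (SUP x. ereal (f x))"
  unfolding coherent_def by blast

lemma coherent_subadditive: "coherent Q \<Longrightarrow> Q (\<lambda>x. f x + g x) \<le> Q f + Q g"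
  unfolding coherent_def by blast

lemma coherent_cmult:
  assumes "coherent Q" "0 \<le> c"
  shows "Q (\<lambda>x. c * f x) = ereal c * Q f"
  using assms unfolding coherent_def by blast

lemma coherent_zero: "coherent Q \<Longrightarrow> Q (\<lambda>_. 0) = 0"
  using coherent_cmult[of Q 0] by (simp flip: zero_ereal_def)

lemma coherent_finite:
  assumes "coherent Q"
  obtains r where "Q f = ereal r"
proof -
  have fin: "Q g < \<infinity>" for g
  proof -
    have "Q g \<le> (SUP x. ereal (g x))" by (rule coherent_le_SUP[OF assms])
    also have "\<dots> \<le> ereal (Max (range g))" by (rule SUP_least) auto
    finally show ?thesis by (auto simp: less_top[symmetric])
  qed
  have "Q (\<lambda>x. f x + - f x) \<le> Q f + Q (\<lambda>x. - f x)"
    by (rule coherent_subadditive[OF assms])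
  then have "0 \<le> Q f + Q (\<lambda>x. - f x)" by (simp add: coherent_zero[OF assms])
  with fin[of f] fin[of "\<lambda>x. - f x"] show ?thesis
    by (cases "Q f"; cases "Q (\<lambda>x. - f x)") (auto intro: that)
qed

lemma coherent_const:
  assumes "coherent Q"
  shows "Q (\<lambda>_. r) = ereal r"
proof -
  have le: "Q (\<lambda>_. c) \<le> ereal c" for c
    using coherent_le_SUP[OF assms, of "\<lambda>_. c"] by simp
  have "Q (\<lambda>_. r + - r) \<le> Q (\<lambda>_. r) + Q (\<lambda>_. - r)"
    by (rule coherent_subadditive[OF assms])
  then have "0 \<le> Q (\<lambda>_. r) + Q (\<lambda>_. - r)" by (simp add: coherent_zero[OF assms])
  with le[of r] le[of "-r"] show ?thesis
    by (cases "Q (\<lambda>_. r)"; cases "Q (\<lambda>_. - r)") auto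
qed

lemma coherent_add_le:
  assumes "coherent Q" "\<And>x. f x \<le> g x + h x"
  shows "Q f \<le> Q g + Q h"
proof -
  have "Q f \<le> Q (\<lambda>x. g x + h x)" by (rule coherent_mono[OF assms])
  also have "\<dots> \<le> Q g + Q h" by (rule coherent_subadditive[OF assms(1)])
  finally show ?thesis .
qed

lemma extended_is_extension:
  assumes "coherent Q"
  shows "is_extension Q (extended Q)"
  unfolding extended_def by (rule theI'[OF is_extension_ex1[OF assms]])

lemma extended_real:
  assumes "coherent Q"
  shows "extended Q (\<lambda>x. ereal (f x)) = Q f"
  using extended_is_extension[OF assms] unfolding is_extension_def by blast

lemma extended_tendsto:
  assumes Q: "coherent Q" and f: "bounded_below f"
  shows "((\<lambda>c. Q (\<lambda>x. real_of_ereal (min (f x) (ereal c)))) \<longlongrightarrow> extended Q f) at_top"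
proof -
  obtain b where b: "\<And>x. ereal b \<le> f x" using f unfolding bounded_below_def by auto
  have "extended Q (\<lambda>x. min (f x) (ereal c)) = Q (\<lambda>x. real_of_ereal (min (f x) (ereal c)))" for c
    using extended_real[OF Q, of "\<lambda>x. real_of_ereal (min (f x) (ereal c))"]
    by (simp only: real_min_ereal[OF b])
  moreover have "((\<lambda>c. extended Q (\<lambda>x. min (f x) (ereal c))) \<longlongrightarrow> extended Q f) at_top"
    using extended_is_extension[OF Q] f unfolding is_extension_def by blast
  ultimately show ?thesis by simp
qed

text \<open>
  Together with \<open>extended_le\<close> this says that, for bounded below \<open>f\<close>, the extended model is the supremum of
  the local model over the real-valued minorants of \<open>f\<close>.
\<close>

lemma extended_ge:
  assumes Q: "coherent Q" and f: "bounded_below f" and g: "\<And>x. ereal (g x) \<le> f x"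
  shows "Q g \<le> extended Q f"
proof (rule tendsto_lowerbound[OF extended_tendsto[OF Q f] _ trivial_limit_at_top_linorder])
  obtain b where b: "\<And>x. ereal b \<le> f x" using f unfolding bounded_below_def by auto
  show "\<forall>\<^sub>F c in at_top. Q g \<le> Q (\<lambda>x. real_of_ereal (min (f x) (ereal c)))"
    unfolding eventually_at_top_linorder
  proof (intro exI allI impI coherent_mono[OF Q])
    fix c x assume c: "Max (range g) \<le> c"
    have "g x \<le> c" using c by (meson Max_ge finite finite_imageI order_trans rangeI)
    then have "ereal (g x) \<le> min (f x) (ereal c)" using g by simp
    then show "g x \<le> real_of_ereal (min (f x) (ereal c))"
      using real_min_ereal[OF b, of x c] by (metis ereal_less_eq(3))
  qed
qed

lemma extended_le:
  assumes Q: "coherent Q" and f: "bounded_below f"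
    and le: "\<And>g. (\<And>x. ereal (g x) \<le> f x) \<Longrightarrow> Q g \<le> y"
  shows "extended Q f \<le> y"
proof (rule tendsto_upperbound[OF extended_tendsto[OF Q f] _ trivial_limit_at_top_linorder])
  obtain b where b: "\<And>x. ereal b \<le> f x" using f unfolding bounded_below_def by auto
  show "\<forall>\<^sub>F c in at_top. Q (\<lambda>x. real_of_ereal (min (f x) (ereal c))) \<le> y"
    by (intro always_eventually allI le) (simp add: real_min_ereal[OF b])
qed

text \<open>
  Monotone convergence for a local model. The state space is finite, so pointwise increasing convergence
  above a real function \<open>g\<close> is uniform: a single index brings \<open>F N\<close> within \<open>\<epsilon>\<close> of \<open>g\<close> in all states.
\<close>

lemma extended_SUP_le:
  fixes F :: "nat \<Rightarrow> 'x::finite \<Rightarrow> real"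
  assumes Q: "coherent Q" and mono: "\<And>N x. F N x \<le> F (Suc N) x" and le: "\<And>N. Q (F N) \<le> y"
  shows "extended Q (\<lambda>x. SUP N. ereal (F N x)) \<le> y"
proof (rule extended_le[OF Q])
  have "ereal (Min (range (F 0))) \<le> (SUP N. ereal (F N x))" for x
    by (rule SUP_upper2[of 0]) auto
  then show "bounded_below (\<lambda>x. SUP N. ereal (F N x))" unfolding bounded_below_def by blast
next
  fix g assume g: "\<And>x. ereal (g x) \<le> (SUP N. ereal (F N x))"
  have mono': "F N x \<le> F N' x" if "N \<le> N'" for N N' x
    using lift_Suc_mono_le[of "\<lambda>N. F N x", OF mono that] .
  show "Q g \<le> y"
  proof (rule ereal_le_epsilon2)
    fix \<epsilon> :: real assume "0 < \<epsilon>"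
    have "\<exists>N. g x < F N x + \<epsilon>" for x
    proof -
      have "ereal (g x - \<epsilon>) < ereal (g x)" using \<open>0 < \<epsilon>\<close> by simp
      also note g[of x]
      finally show ?thesis unfolding less_SUP_iff by (auto simp: algebra_simps)
    qed
    then obtain n where n: "\<And>x. g x < F (n x) x + \<epsilon>" by metis
    have "g x \<le> F (Max (range n)) x + \<epsilon>" for x
      using n[of x] mono'[of "n x" "Max (range n)" x] by force
    then have "Q g \<le> Q (F (Max (range n))) + Q (\<lambda>_. \<epsilon>)" by (rule coherent_add_le[OF Q])
    also have "\<dots> \<le> y + ereal \<epsilon>" unfolding coherent_const[OF Q] by (rule add_right_mono[OF le])
    finally show "Q g \<le> y + ereal \<epsilon>" .
  qed
qed

section \<open>Paths and finitary gambles\<close>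

lemma length_path_prefix [simp]: "length (path_prefix n \<omega>) = n"
  by (simp add: path_prefix_def)

lemma path_prefix_Suc: "path_prefix (Suc n) \<omega> = path_prefix n \<omega> @ [\<omega> n]"
  by (simp add: path_prefix_def)

lemma nth_path_prefix [simp]: "i < n \<Longrightarrow> path_prefix n \<omega> ! i = \<omega> i"
  by (simp add: path_prefix_def)

lemma take_path_prefix: "take m (path_prefix n \<omega>) = path_prefix (min m n) \<omega>"
  by (rule nth_equalityI) auto

lemma cylinder_iff: "\<omega> \<in> cylinder s \<longleftrightarrow> path_prefix (length s) \<omega> = s"
  by (simp add: cylinder_def)

lemma cylinder_nonempty: obtains \<omega> where "\<omega> \<in> cylinder s"
proof
  show "(\<lambda>i. s ! i) \<in> cylinder s"
    unfolding cylinder_iff by (rule nth_equalityI) auto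
qed

lemma cylinder_snoc: "\<omega> \<in> cylinder (s @ [x]) \<longleftrightarrow> \<omega> \<in> cylinder s \<and> \<omega> (length s) = x"
  by (simp add: cylinder_iff path_prefix_Suc)

lemma prefix_function_finitary:
  fixes \<phi> :: "('x::finite) list \<Rightarrow> real"
  shows "gamble (\<lambda>\<omega>. ereal (\<phi> (path_prefix n \<omega>)))"
    and "n_measurable n (\<lambda>\<omega>. ereal (\<phi> (path_prefix n \<omega>)))"
    and "(\<lambda>\<omega>. ereal (\<phi> (path_prefix n \<omega>))) \<in> V_fin"
proof -
  have fin: "finite {t::'x list. length t = n}"
    using finite_lists_length_eq[of "UNIV::'x set" n] by simp
  have "\<bar>\<phi> (path_prefix n \<omega>)\<bar> \<le> Max ((\<lambda>t. \<bar>\<phi> t\<bar>) ` {t. length t = n})" for \<omega>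
    using fin by (intro Max_ge) auto
  then show g: "gamble (\<lambda>\<omega>. ereal (\<phi> (path_prefix n \<omega>)))"
    unfolding gamble_def by auto
  show m: "n_measurable n (\<lambda>\<omega>. ereal (\<phi> (path_prefix n \<omega>)))"
    unfolding n_measurable_def by simp
  show "(\<lambda>\<omega>. ereal (\<phi> (path_prefix n \<omega>))) \<in> V_fin"
    using g m unfolding V_fin_def by blast
qed

lemma V_fin_prefix_function:
  fixes g :: "('x::finite) gvar"
  assumes "gamble g" "n_measurable N g"
  obtains \<phi> :: "'x list \<Rightarrow> real" where "g = (\<lambda>\<omega>. ereal (\<phi> (path_prefix N \<omega>)))"
proof -
  obtain B where B: "\<And>\<omega>. \<bar>g \<omega>\<bar> \<le> ereal B" using assms(1) unfolding gamble_def by auto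
  have r: "ereal (real_of_ereal (g \<omega>)) = g \<omega>" for \<omega>
    using B[of \<omega>] by (cases "g \<omega>") auto
  define \<phi> where "\<phi> t = real_of_ereal (g (SOME \<omega>. path_prefix N \<omega> = t))" for t
  have "g \<omega> = ereal (\<phi> (path_prefix N \<omega>))" for \<omega>
  proof -
    have "path_prefix N (SOME \<omega>'. path_prefix N \<omega>' = path_prefix N \<omega>) = path_prefix N \<omega>"
      by (rule someI[of _ \<omega>]) simp
    then have "g (SOME \<omega>'. path_prefix N \<omega>' = path_prefix N \<omega>) = g \<omega>"
      using assms(2) unfolding n_measurable_def by blast
    then show ?thesis by (simp add: \<phi>_def r)
  qed
  then show ?thesis by (intro that) auto
qed

lemma V_fin_min:
  assumes "f \<in> V_fin" "g \<in> V_fin"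
  shows "(\<lambda>\<omega>. min (f \<omega>) (g \<omega>)) \<in> V_fin"
proof -
  obtain A m B n where *: "\<And>\<omega>. \<bar>f \<omega>\<bar> \<le> ereal A" "n_measurable m f"
      "\<And>\<omega>. \<bar>g \<omega>\<bar> \<le> ereal B" "n_measurable n g"
    using assms unfolding V_fin_def gamble_def by blast
  have pp: "path_prefix m \<omega> = path_prefix m \<omega>'"
    if "path_prefix k \<omega> = path_prefix k \<omega>'" "m \<le> k" for m k and \<omega> \<omega>' :: "nat \<Rightarrow> 'a"
    using that by (metis min.absorb1 take_path_prefix)
  have "n_measurable (max m n) (\<lambda>\<omega>. min (f \<omega>) (g \<omega>))"
    using *(2,4) pp unfolding n_measurable_def by (metis max.cobounded1 max.cobounded2)
  moreover have "\<bar>min (f \<omega>) (g \<omega>)\<bar> \<le> ereal (max A B)" for \<omega>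
    using *(1)[of \<omega>] *(3)[of \<omega>] by (auto simp: min_def intro: order_trans)
  ultimately show ?thesis unfolding V_fin_def gamble_def by blast
qed

section \<open>Supermartingales\<close>

definition real_supermartingale :: "('x::finite) tree \<Rightarrow> ('x list \<Rightarrow> real) \<Rightarrow> bool" where
  "real_supermartingale Q m \<longleftrightarrow> (\<forall>t. Q t (\<lambda>x. m (t @ [x])) \<le> ereal (m t))"

lemma real_supermartingaleD:
  "real_supermartingale Q m \<Longrightarrow> Q t (\<lambda>x. m (t @ [x])) \<le> ereal (m t)"
  by (simp add: real_supermartingale_def)

lemma tree_coherent: "imprecise_tree Q \<Longrightarrow> coherent (Q t)"
  by (simp add: imprecise_tree_def)

lemma real_supermartingale_supermartingale:
  assumes "imprecise_tree Q"
  shows "supermartingale Q (\<lambda>t. ereal (m t)) \<longleftrightarrow> real_supermartingale Q m"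
  by (simp add: supermartingale_def real_supermartingale_def extended_real[OF tree_coherent[OF assms]])

lemma real_supermartingale_const:
  assumes "imprecise_tree Q"
  shows "real_supermartingale Q (\<lambda>t. c)"
  by (simp add: real_supermartingale_def coherent_const[OF tree_coherent[OF assms]])

lemma real_supermartingale_add:
  assumes Q: "imprecise_tree Q" and "real_supermartingale Q m" "real_supermartingale Q m'"
  shows "real_supermartingale Q (\<lambda>t. m t + m' t)"
  unfolding real_supermartingale_def
proof
  fix t
  have "Q t (\<lambda>x. m (t @ [x]) + m' (t @ [x])) \<le> Q t (\<lambda>x. m (t @ [x])) + Q t (\<lambda>x. m' (t @ [x]))"
    by (rule coherent_add_le[OF tree_coherent[OF Q]]) simp
  also have "\<dots> \<le> ereal (m t) + ereal (m' t)"
    by (intro add_mono real_supermartingaleD assms)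
  finally show "Q t (\<lambda>x. m (t @ [x]) + m' (t @ [x])) \<le> ereal (m t + m' t)" by simp
qed

lemma real_supermartingale_cmult:
  assumes Q: "imprecise_tree Q" and m: "real_supermartingale Q m" and c: "0 \<le> c"
  shows "real_supermartingale Q (\<lambda>t. c * m t)"
  unfolding real_supermartingale_def coherent_cmult[OF tree_coherent[OF Q] c]
  using ereal_mult_left_mono[OF real_supermartingaleD[OF m], of "ereal c"] c by simp

lemma real_supermartingale_sum:
  assumes Q: "imprecise_tree Q" and "\<And>i. i \<in> I \<Longrightarrow> real_supermartingale Q (m i)"
  shows "real_supermartingale Q (\<lambda>t. \<Sum>i\<in>I. m i t)"
  using assms(2)
  by (induction I rule: infinite_finite_induct)
    (auto intro: real_supermartingale_const[OF Q] real_supermartingale_add[OF Q])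

lemma real_supermartingale_INF:
  assumes Q: "imprecise_tree Q" and m: "\<And>k::nat. real_supermartingale Q (m k)"
    and L: "\<And>k t. L \<le> m k t"
  shows "real_supermartingale Q (\<lambda>t. INF k. m k t)"
  unfolding real_supermartingale_def
proof
  fix t
  have bdd: "bdd_below (range (\<lambda>k. m k t))" for t by (rule bdd_belowI2[of _ L]) (rule L)
  obtain r where r: "Q t (\<lambda>x. INF k. m k (t @ [x])) = ereal r"
    using coherent_finite[OF tree_coherent[OF Q]] by blast
  have "r \<le> m k t" for k
  proof -
    have "ereal r \<le> Q t (\<lambda>x. m k (t @ [x]))"
      unfolding r[symmetric] by (intro coherent_mono[OF tree_coherent[OF Q]] cINF_lower bdd) simp
    also have "\<dots> \<le> ereal (m k t)" by (rule real_supermartingaleD[OF m])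
    finally show ?thesis by simp
  qed
  then show "Q t (\<lambda>x. INF k. m k (t @ [x])) \<le> ereal (INF k. m k t)"
    unfolding r by (auto intro: cINF_greatest)
qed

lemma supermartingale_SUP:
  assumes Q: "imprecise_tree Q" and m: "\<And>N. real_supermartingale Q (m N)"
    and mono: "\<And>N t. m N t \<le> m (Suc N) t"
  shows "supermartingale Q (\<lambda>t. SUP N. ereal (m N t))"
  unfolding supermartingale_def
proof (intro allI extended_SUP_le tree_coherent Q mono)
  fix t N
  show "Q t (\<lambda>x. m N (t @ [x])) \<le> (SUP N. ereal (m N t))"
    by (rule SUP_upper2[of N]) (simp_all add: real_supermartingaleD[OF m])
qed

lemma bounded_below_next: "bounded_below M \<Longrightarrow> bounded_below (\<lambda>x. M (t @ [x]))"
  unfolding bounded_below_def by blast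

text \<open>
  Truncating from above keeps the supermartingale property, because a local model is monotone and maps
  the constant \<open>c\<close> to itself. It makes the process real-valued, so that the trading strategies below
  never meet infinite increments.
\<close>

lemma supermartingale_truncate:
  assumes Q: "imprecise_tree Q" and M: "supermartingale Q M" and b: "\<And>t. ereal L \<le> M t"
  shows "real_supermartingale Q (\<lambda>t. real_of_ereal (min (M t) (ereal c)))"
  unfolding real_supermartingale_def real_min_ereal[OF b]
proof (intro allI min.boundedI)
  fix t
  have "Q t (\<lambda>x. real_of_ereal (min (M (t @ [x])) (ereal c))) \<le> extended (Q t) (\<lambda>x. M (t @ [x]))"
    using b by (intro extended_ge[OF tree_coherent[OF Q]] bounded_below_next)
      (auto simp: real_min_ereal[OF b] bounded_below_def)
  also have "\<dots> \<le> M t" using M by (simp add: supermartingale_def)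
  finally show "Q t (\<lambda>x. real_of_ereal (min (M (t @ [x])) (ereal c))) \<le> M t" .
  have "real_of_ereal (min (M (t @ [x])) (ereal c)) \<le> c" for x
    using real_min_ereal[OF b, of "t @ [x]" c] by (metis ereal_less_eq(3) min.cobounded2)
  then have "Q t (\<lambda>x. real_of_ereal (min (M (t @ [x])) (ereal c))) \<le> Q t (\<lambda>_. c)"
    by (rule coherent_mono[OF tree_coherent[OF Q]])
  then show "Q t (\<lambda>x. real_of_ereal (min (M (t @ [x])) (ereal c))) \<le> ereal c"
    by (simp add: coherent_const[OF tree_coherent[OF Q]])
qed

text \<open>
  If every successor value exceeded \<open>M t\<close>, finiteness of the state space would leave room for a constant
  \<open>r > M t\<close> below all of them, and the local upper expectation would be at least \<open>r\<close>.
\<close>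

lemma supermartingale_step_down:
  assumes Q: "imprecise_tree Q" and M: "supermartingale Q M" and b: "bounded_below M"
  shows "\<exists>x. M (t @ [x]) \<le> M t"
proof (rule ccontr)
  assume "\<not> ?thesis"
  then have less: "M t < M (t @ [x])" for x by (simp add: not_le)
  then have "M t < Min (range (\<lambda>x. M (t @ [x])))" by simp
  then obtain r where r: "M t < ereal r" "ereal r < Min (range (\<lambda>x. M (t @ [x])))"
    using ereal_dense2 by blast
  have "ereal r = Q t (\<lambda>_. r)" by (simp add: coherent_const[OF tree_coherent[OF Q]])
  also have "\<dots> \<le> extended (Q t) (\<lambda>x. M (t @ [x]))"
    using r(2) by (intro extended_ge[OF tree_coherent[OF Q]] bounded_below_next b) (simp add: less_imp_le)
  also have "\<dots> \<le> M t" using M by (simp add: supermartingale_def)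
  finally show False using r(1) by simp
qed

lemma supermartingale_descending_path:
  assumes "imprecise_tree Q" "supermartingale Q M" "bounded_below M"
  obtains \<omega> where "\<omega> \<in> cylinder t" "\<And>j. length t \<le> j \<Longrightarrow> M (path_prefix j \<omega>) \<le> M t"
proof -
  obtain nx where nx: "\<And>u. M (u @ [nx u]) \<le> M u"
    using supermartingale_step_down[OF assms] by metis
  \<comment> \<open>first spell out the given situation, then keep moving to a state in which \<open>M\<close> does not increase\<close>
  define y where "y n p = (if n < length t then t ! n else nx p)" for n p
  define p where "p = rec_nat [] (\<lambda>n p. p @ [y n p])"
  have p: "p 0 = []" "p (Suc n) = p n @ [y n (p n)]" for n by (simp_all add: p_def)
  define \<omega> where "\<omega> n = y n (p n)" for n
  have pp: "path_prefix n \<omega> = p n" for n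
    by (induction n) (auto simp: p path_prefix_Suc \<omega>_def, simp add: path_prefix_def)
  have "\<omega> \<in> cylinder t"
    unfolding cylinder_iff by (rule nth_equalityI) (auto simp: \<omega>_def y_def)
  moreover have "M (path_prefix j \<omega>) \<le> M t" if "length t \<le> j" for j
    using that
  proof (induction j rule: dec_induct)
    case base
    then show ?case using \<open>\<omega> \<in> cylinder t\<close> by (simp add: cylinder_iff)
  next
    case (step j)
    then have "path_prefix (Suc j) \<omega> = path_prefix j \<omega> @ [nx (path_prefix j \<omega>)]"
      by (simp add: pp p y_def)
    then show ?case using nx[of "path_prefix j \<omega>"] step.IH by simp
  qed
  ultimately show ?thesis by (rule that)
qed

primrec backward :: "('x::finite) tree \<Rightarrow> ('x list \<Rightarrow> real) \<Rightarrow> nat \<Rightarrow> 'x list \<Rightarrow> real" where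
  "backward Q \<phi> 0 t = \<phi> t"
| "backward Q \<phi> (Suc k) t = real_of_ereal (Q t (\<lambda>x. backward Q \<phi> k (t @ [x])))"

text \<open>
  Backward recursion from time \<open>N\<close>, where the gamble is known. From \<open>N\<close> on the process is frozen at that
  value, so that the martingale equation holds in all situations.
\<close>

lemma finitary_martingale:
  assumes Q: "imprecise_tree Q" and g: "gamble g" "n_measurable N g"
  obtains W where "\<And>t. Q t (\<lambda>x. W (t @ [x])) = ereal (W t)"
    and "\<And>\<omega> j. N \<le> j \<Longrightarrow> ereal (W (path_prefix j \<omega>)) = g \<omega>"
proof -
  obtain \<phi> where \<phi>: "g = (\<lambda>\<omega>. ereal (\<phi> (path_prefix N \<omega>)))"
    using V_fin_prefix_function[OF g] .
  define W where "W t = backward Q (\<lambda>t. \<phi> (take N t)) (N - length t) t" for t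
  have "Q t (\<lambda>x. W (t @ [x])) = ereal (W t)" for t
  proof (cases "length t < N")
    case True
    then have *: "N - length t = Suc (N - Suc (length t))" by simp
    show ?thesis
      unfolding W_def * using coherent_finite[OF tree_coherent[OF Q, of t]]
      by (simp add: ) (metis real_of_ereal.simps(1))
  next
    case False
    then show ?thesis by (simp add: W_def coherent_const[OF tree_coherent[OF Q]])
  qed
  moreover have "ereal (W (path_prefix j \<omega>)) = g \<omega>" if "N \<le> j" for \<omega> j
    using that by (simp add: W_def \<phi> take_path_prefix min_absorb1)
  ultimately show ?thesis by (rule that)
qed

section \<open>Finitary gambles under the axioms\<close>

lemma E_V_le:
  assumes "supermartingale Q M" "bounded_below M"
    and "\<And>\<omega>. \<omega> \<in> cylinder s \<Longrightarrow> f \<omega> \<le> liminf (\<lambda>n. M (path_prefix n \<omega>))"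
  shows "E_V Q f s \<le> M s"
  unfolding E_V_def using assms by (intro Inf_lower) blast

lemma E_V_ge:
  assumes "\<And>M. supermartingale Q M \<Longrightarrow> bounded_below M \<Longrightarrow>
    (\<And>\<omega>. \<omega> \<in> cylinder s \<Longrightarrow> f \<omega> \<le> liminf (\<lambda>n. M (path_prefix n \<omega>))) \<Longrightarrow> y \<le> M s"
  shows "y \<le> E_V Q f s"
  unfolding E_V_def using assms by (intro Inf_greatest) blast

lemma E_V_mono:
  assumes "\<And>\<omega>. \<omega> \<in> cylinder s \<Longrightarrow> f \<omega> \<le> g \<omega>"
  shows "E_V Q f s \<le> E_V Q g s"
  by (rule E_V_ge, rule E_V_le) (auto intro: order_trans[OF assms])

text \<open>
  The hypothesis covers all situations of the next length, not just the successors of \<open>t\<close>, because P3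
  evaluates \<open>E f\<close> along all paths.
\<close>

lemma backward_induct [consumes 0, case_names late earlier]:
  assumes late: "\<And>t. N \<le> length t \<Longrightarrow> P t"
    and earlier: "\<And>t. (\<And>u. length u = Suc (length t) \<Longrightarrow> P u) \<Longrightarrow> P t"
  shows "P t"
proof (induction "N - length t" arbitrary: t)
  case 0
  then show ?case by (intro late) simp
next
  case (Suc k)
  show ?case by (rule earlier, rule Suc.hyps) (use Suc.hyps(2) in simp)
qed

lemma martingale_lower_bound:
  assumes Q: "imprecise_tree Q" and W: "\<And>t. Q t (\<lambda>x. W (t @ [x])) = ereal (W t)"
    and g: "\<And>\<omega> j. N \<le> j \<Longrightarrow> ereal (W (path_prefix j \<omega>)) = g \<omega>"
    and L: "\<And>\<omega>. ereal L \<le> g \<omega>"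
  shows "L \<le> W t"
proof (induction t rule: backward_induct[of N])
  case (late t)
  obtain \<omega> where "\<omega> \<in> cylinder t" by (rule cylinder_nonempty)
  then show ?case using g[OF late, of \<omega>] L[of \<omega>] by (simp add: cylinder_iff flip: ereal_less_eq(3))
next
  case (earlier t)
  have "ereal L = Q t (\<lambda>_. L)" by (simp add: coherent_const[OF tree_coherent[OF Q]])
  also have "\<dots> \<le> Q t (\<lambda>x. W (t @ [x]))"
    by (intro coherent_mono[OF tree_coherent[OF Q]] earlier) simp
  finally show ?case by (simp add: W)
qed

lemma gamble_bounded_below:
  assumes "gamble g" obtains L where "\<And>\<omega>. ereal L \<le> g \<omega>"
proof -
  obtain B where B: "\<And>\<omega>. \<bar>g \<omega>\<bar> \<le> ereal B" using assms unfolding gamble_def by auto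
  have "ereal (- B) \<le> g \<omega>" for \<omega> using B[of \<omega>] by (cases "g \<omega>") auto
  then show ?thesis by (rule that)
qed

lemma liminf_eventually_const:
  fixes X :: "nat \<Rightarrow> ereal"
  assumes "\<And>j. N \<le> j \<Longrightarrow> X j = c"
  shows "liminf X = c"
  by (intro lim_imp_Liminf tendsto_eventually) (use assms in \<open>auto simp: eventually_sequentially\<close>)

text \<open>
  The martingale \<open>W\<close> itself is admissible in the infimum defining \<open>E_V\<close>. Conversely, an admissible \<open>M\<close> stays
  above \<open>W\<close>: from time \<open>N\<close> on, because along a path on which \<open>M\<close> never rises above its present value its
  limit inferior still dominates \<open>g\<close>; and earlier by backward induction.
\<close>

lemma E_V_finitary:
  assumes Q: "imprecise_tree Q" and W: "\<And>t. Q t (\<lambda>x. W (t @ [x])) = ereal (W t)"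
    and g: "\<And>\<omega> j. N \<le> j \<Longrightarrow> ereal (W (path_prefix j \<omega>)) = g \<omega>" and "gamble g"
  shows "E_V Q g s = ereal (W s)"
proof (rule antisym)
  obtain L where L: "\<And>\<omega>. ereal L \<le> g \<omega>" using gamble_bounded_below[OF \<open>gamble g\<close>] by blast
  show "E_V Q g s \<le> ereal (W s)"
  proof (rule E_V_le)
    show "supermartingale Q (\<lambda>t. ereal (W t))"
      by (simp add: real_supermartingale_supermartingale[OF Q] real_supermartingale_def W)
    show "bounded_below (\<lambda>t. ereal (W t))"
      using martingale_lower_bound[OF Q W g L] by (auto simp: bounded_below_def)
    show "g \<omega> \<le> liminf (\<lambda>n. ereal (W (path_prefix n \<omega>)))" for \<omega>
      by (simp add: liminf_eventually_const[OF g])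
  qed
  show "ereal (W s) \<le> E_V Q g s"
  proof (rule E_V_ge)
    fix M assume M: "supermartingale Q M" "bounded_below M"
      and lim: "\<And>\<omega>. \<omega> \<in> cylinder s \<Longrightarrow> g \<omega> \<le> liminf (\<lambda>n. M (path_prefix n \<omega>))"
    have "cylinder t \<subseteq> cylinder s \<longrightarrow> ereal (W t) \<le> M t" for t
    proof (induction t rule: backward_induct[of N])
      case (late t)
      obtain \<omega> where \<omega>: "\<omega> \<in> cylinder t" "\<And>j. length t \<le> j \<Longrightarrow> M (path_prefix j \<omega>) \<le> M t"
        using supermartingale_descending_path[OF Q M] by blast
      have "ereal (W t) = g \<omega>" using g[OF late, of \<omega>] \<omega>(1) by (simp add: cylinder_iff)
      moreover have "liminf (\<lambda>n. M (path_prefix n \<omega>)) \<le> M t"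
      proof -
        have "liminf (\<lambda>n. M (path_prefix n \<omega>)) \<le> liminf (\<lambda>n. M t)"
          using \<omega>(2) by (intro Liminf_mono) (auto simp: eventually_sequentially)
        then show ?thesis by (simp add: Liminf_const)
      qed
      ultimately show ?case using lim[of \<omega>] \<omega>(1) by auto
    next
      case (earlier t)
      show ?case
      proof
        assume t: "cylinder t \<subseteq> cylinder s"
        then have "ereal (W (t @ [x])) \<le> M (t @ [x])" for x
          using earlier[of "t @ [x]"] by (auto simp: cylinder_snoc)
        then have "Q t (\<lambda>x. W (t @ [x])) \<le> extended (Q t) (\<lambda>x. M (t @ [x]))"
          by (intro extended_ge[OF tree_coherent[OF Q]] bounded_below_next M)
        also have "\<dots> \<le> M t" using M by (simp add: supermartingale_def)
        finally show "ereal (W t) \<le> M t" by (simp add: W)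
      qed
    qed
    then show "ereal (W s) \<le> M s" by simp
  qed
qed

lemma coordinate_function_V_fin:
  fixes k :: "'x::finite \<Rightarrow> real"
  shows "gamble (\<lambda>\<omega>. ereal (k (\<omega> n)))" "n_measurable (Suc n) (\<lambda>\<omega>. ereal (k (\<omega> n)))"
    "(\<lambda>\<omega>. ereal (k (\<omega> n))) \<in> V_fin"
  using prefix_function_finitary[where \<phi> = "\<lambda>t. k (last t)" and n = "Suc n"] by (simp_all add: path_prefix_Suc)

lemma E_V_P1:
  fixes Q :: "('x::finite) tree"
  assumes Q: "imprecise_tree Q"
  shows "P1 Q (E_V Q)"
  unfolding P1_def
proof (intro allI)
  fix k :: "'x \<Rightarrow> real" and s :: "'x list"
  obtain W where W: "\<And>t. Q t (\<lambda>x. W (t @ [x])) = ereal (W t)"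
    and g: "\<And>\<omega> j. Suc (length s) \<le> j \<Longrightarrow> ereal (W (path_prefix j \<omega>)) = ereal (k (\<omega> (length s)))"
    using finitary_martingale[OF Q coordinate_function_V_fin(1)[of k "length s"] coordinate_function_V_fin(2)]
    by metis
  have "W (s @ [x]) = k x" for x
  proof -
    obtain \<omega> where "\<omega> \<in> cylinder (s @ [x])" by (rule cylinder_nonempty)
    then show ?thesis using g[of "Suc (length s)" \<omega>]
      by (simp add: cylinder_snoc path_prefix_Suc) (simp add: cylinder_iff)
  qed
  then have "ereal (W s) = Q s k" using W[of s] by simp
  then show "E_V Q (\<lambda>\<omega>. ereal (k (\<omega> (length s)))) s = Q s k"
    using E_V_finitary[OF Q W g coordinate_function_V_fin(1)] by simp
qed

lemma E_V_P2: "P2 (E_V Q)"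
  unfolding P2_def by (intro ballI allI antisym E_V_mono) simp_all

lemma E_V_P4: "P4 (E_V Q)"
  unfolding P4_def by (simp add: E_V_mono)

text \<open>
  P1 only concerns gambles of the form \<open>k (X_{n+1})\<close>; P2 extends it to finitary gambles that have this form
  on the cylinder of \<open>s\<close> alone.
\<close>

lemma one_step_gamble:
  fixes k :: "'x::finite \<Rightarrow> real"
  assumes "P1 Q E" "P2 E" "g \<in> V_fin"
    and g: "\<And>\<omega>. \<omega> \<in> cylinder s \<Longrightarrow> g \<omega> = ereal (k (\<omega> (length s)))"
  shows "E g s = Q s k"
proof -
  let ?h = "\<lambda>\<omega>. ereal (k (\<omega> (length s)))"
  have "E g s = E (\<lambda>\<omega>. g \<omega> * indicator (cylinder s) \<omega>) s"
    using assms(2,3) by (simp add: P2_def)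
  also have "(\<lambda>\<omega>. g \<omega> * indicator (cylinder s) \<omega>) = (\<lambda>\<omega>. ?h \<omega> * indicator (cylinder s) \<omega>)"
    by (auto simp: g indicator_def fun_eq_iff)
  also have "E \<dots> s = E ?h s"
    using assms(2) coordinate_function_V_fin(3)[of k "length s"] by (simp add: P2_def)
  also have "\<dots> = Q s k" using assms(1) by (simp add: P1_def)
  finally show ?thesis .
qed

lemma one_step_martingale:
  fixes Q :: "('x::finite) tree"
  assumes "P1 Q E" "P2 E" and W: "\<And>t. Q t (\<lambda>x. W (t @ [x])) = ereal (W t)"
  shows "E (\<lambda>\<omega>. ereal (W (path_prefix (length s + 1) \<omega>))) s = ereal (W s)"
  unfolding W[of s, symmetric]
  by (rule one_step_gamble[OF assms(1,2) prefix_function_finitary(3)])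
    (simp add: path_prefix_Suc cylinder_iff)

lemma E_V_P3_eq:
  assumes Q: "imprecise_tree Q"
  shows "P3_eq (E_V Q)"
  unfolding P3_eq_def
proof (intro ballI allI)
  fix f :: "'a gvar" and n \<omega> assume "f \<in> V_fin"
  then obtain N where f: "gamble f" "n_measurable N f" by (auto simp: V_fin_def)
  obtain W where W: "\<And>t. Q t (\<lambda>x. W (t @ [x])) = ereal (W t)"
    and g: "\<And>\<omega> j. N \<le> j \<Longrightarrow> ereal (W (path_prefix j \<omega>)) = f \<omega>"
    using finitary_martingale[OF Q f] by metis
  show "E_V Q f (path_prefix n \<omega>) = E_V Q (\<lambda>\<omega>'. E_V Q f (path_prefix (n + 1) \<omega>')) (path_prefix n \<omega>)"
    using one_step_martingale[OF E_V_P1[OF Q] E_V_P2 W, of "path_prefix n \<omega>"]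
    by (simp add: E_V_finitary[OF Q W g f(1)])
qed

lemma expectation_finitary_late:
  assumes E: "P1 Q E" "P2 E" and Q: "imprecise_tree Q"
    and g: "\<And>\<omega> j. N \<le> j \<Longrightarrow> ereal (W (path_prefix j \<omega>)) = g \<omega>" "g \<in> V_fin" and s: "N \<le> length s"
  shows "E g s = ereal (W s)"
proof -
  have "E g s = Q s (\<lambda>_. W s)"
    by (rule one_step_gamble[OF E g(2)]) (use g(1)[OF s] in \<open>metis cylinder_iff\<close>)
  then show ?thesis by (simp add: coherent_const[OF tree_coherent[OF Q]])
qed

lemma expectation_finitary_le_E_V:
  assumes Q: "imprecise_tree Q" and E: "P1 Q E" "P2 E" "P3 E" "P4 E" and g: "g \<in> V_fin"
  shows "E g s \<le> E_V Q g s"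
proof -
  obtain N where gN: "gamble g" "n_measurable N g" using g by (auto simp: V_fin_def)
  obtain W where W: "\<And>t. Q t (\<lambda>x. W (t @ [x])) = ereal (W t)"
    and Wg: "\<And>\<omega> j. N \<le> j \<Longrightarrow> ereal (W (path_prefix j \<omega>)) = g \<omega>"
    using finitary_martingale[OF Q gN] by metis
  have "E g s \<le> ereal (W s)"
  proof (induction s rule: backward_induct[of N])
    case (late s)
    then show ?case by (simp add: expectation_finitary_late[OF E(1,2) Q Wg g])
  next
    case (earlier s)
    obtain \<omega> where \<omega>: "\<omega> \<in> cylinder s" by (rule cylinder_nonempty)
    have "E g s \<le> E (\<lambda>\<omega>'. E g (path_prefix (length s + 1) \<omega>')) s"
      using E(3) g \<omega> unfolding P3_def cylinder_iff by metis
    also have "\<dots> \<le> E (\<lambda>\<omega>'. ereal (W (path_prefix (length s + 1) \<omega>'))) s"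
      using E(4) earlier unfolding P4_def by simp
    also have "\<dots> = ereal (W s)" by (rule one_step_martingale[OF E(1,2) W])
    finally show ?case .
  qed
  then show ?thesis by (simp add: E_V_finitary[OF Q W Wg gN(1)])
qed

lemma expectation_finitary_eq_E_V:
  assumes Q: "imprecise_tree Q" and E: "P1 Q E" "P2 E" "P3_eq E" and g: "g \<in> V_fin"
  shows "E g s = E_V Q g s"
proof -
  obtain N where gN: "gamble g" "n_measurable N g" using g by (auto simp: V_fin_def)
  obtain W where W: "\<And>t. Q t (\<lambda>x. W (t @ [x])) = ereal (W t)"
    and Wg: "\<And>\<omega> j. N \<le> j \<Longrightarrow> ereal (W (path_prefix j \<omega>)) = g \<omega>"
    using finitary_martingale[OF Q gN] by metis
  have "E g s = ereal (W s)"
  proof (induction s rule: backward_induct[of N])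
    case (late s)
    then show ?case by (simp add: expectation_finitary_late[OF E(1,2) Q Wg g])
  next
    case (earlier s)
    obtain \<omega> where \<omega>: "\<omega> \<in> cylinder s" by (rule cylinder_nonempty)
    have "E g s = E (\<lambda>\<omega>'. E g (path_prefix (length s + 1) \<omega>')) s"
      using E(3) g \<omega> unfolding P3_eq_def cylinder_iff by metis
    also have "\<dots> = E (\<lambda>\<omega>'. ereal (W (path_prefix (length s + 1) \<omega>'))) s"
      by (simp add: earlier)
    also have "\<dots> = ereal (W s)" by (rule one_step_martingale[OF E(1,2) W])
    finally show ?case .
  qed
  then show ?thesis by (simp add: E_V_finitary[OF Q W Wg gN(1)])
qed

section \<open>Profiting from upcrossings\<close>

text \<open>
  The trader's state consists of the number of completed upcrossings and, while a process is held, its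
  index. An available process at level at most \<open>a\<close> is bought, and it is sold at level at least \<open>b\<close>.
\<close>

fun hold_step ::
    "(nat \<Rightarrow> 'x list \<Rightarrow> real) \<Rightarrow> real \<Rightarrow> real \<Rightarrow> 'x list \<Rightarrow> nat \<times> nat option \<Rightarrow> nat \<times> nat option" where
  "hold_step h a b t (U, None) =
     (U, if \<exists>k. h k t \<le> a then Some (SOME k. h k t \<le> a) else None)"
| "hold_step h a b t (U, Some k) = (if b \<le> h k t then (Suc U, None) else (U, Some k))"

text \<open>
  Trading starts only after time \<open>m\<close>, so that the capital is known in the situation of interest, which
  need not be the initial one. The recursion runs over reversed strings because situations grow at the
  end.
\<close>

primrec trader_rev ::
    "(nat \<Rightarrow> 'x list \<Rightarrow> real) \<Rightarrow> real \<Rightarrow> real \<Rightarrow> nat \<Rightarrow> 'x list \<Rightarrow> nat \<times> nat option" where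
  "trader_rev h a b m [] = (0, None)"
| "trader_rev h a b m (x # r) =
     (if length r < m then (0, None) else hold_step h a b (rev (x # r)) (trader_rev h a b m r))"

definition trader ::
    "(nat \<Rightarrow> 'x list \<Rightarrow> real) \<Rightarrow> real \<Rightarrow> real \<Rightarrow> nat \<Rightarrow> 'x list \<Rightarrow> nat \<times> nat option" where
  "trader h a b m t = trader_rev h a b m (rev t)"

lemma trader_snoc:
  "trader h a b m (t @ [x]) =
    (if length t < m then (0, None) else hold_step h a b (t @ [x]) (trader h a b m t))"
  by (simp add: trader_def)

lemma trader_init: "length t \<le> m \<Longrightarrow> trader h a b m t = (0, None)"
  by (cases t rule: rev_cases) (simp_all add: trader_snoc, simp add: trader_def)

text \<open>
  Profits are booked as \<open>b - a\<close> per completed upcrossing and the position held is valued relative to a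
  purchase price \<open>a\<close>. Both are conservative: purchases may be cheaper and sales dearer, and the
  surplus is thrown away.
\<close>

fun wealth ::
    "(nat \<Rightarrow> 'x list \<Rightarrow> real) \<Rightarrow> real \<Rightarrow> real \<Rightarrow> 'x list \<Rightarrow> nat \<times> nat option \<Rightarrow> real" where
  "wealth h a b t (U, None) = (b - a) * real U"
| "wealth h a b t (U, Some k) = (b - a) * real U + (h k t - a)"

text \<open>
  While nothing is held, wealth cannot increase; while process \<open>k\<close> is held, the increment of wealth is at
  most that of \<open>h k\<close>. Which of the two applies is known one step ahead.
\<close>

lemma wealth_supermartingale:
  assumes Q: "imprecise_tree Q" and h: "\<And>k. real_supermartingale Q (h k)"
  shows "real_supermartingale Q (\<lambda>t. wealth h a b t (trader h a b m t))"
  unfolding real_supermartingale_def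
proof
  fix t
  let ?Z = "\<lambda>t. wealth h a b t (trader h a b m t)"
  note coh = tree_coherent[OF Q, of t]
  obtain U p where U: "trader h a b m t = (U, p)" by fastforce
  show "Q t (\<lambda>x. ?Z (t @ [x])) \<le> ereal (?Z t)"
  proof (cases "length t < m")
    case True
    then show ?thesis by (simp add: trader_snoc trader_init coherent_const[OF coh])
  next
    case False
    show ?thesis
    proof (cases p)
      case None
      have "?Z (t @ [x]) \<le> ?Z t" for x
        using False U None someI_ex[of "\<lambda>k. h k (t @ [x]) \<le> a"] by (simp add: trader_snoc)
      then have "Q t (\<lambda>x. ?Z (t @ [x])) \<le> Q t (\<lambda>_. ?Z t)" by (rule coherent_mono[OF coh])
      then show ?thesis by (simp add: coherent_const[OF coh])
    next
      case (Some k)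
      let ?c = "(b - a) * real U - a"
      have "?Z (t @ [x]) \<le> h k (t @ [x]) + ?c" for x
        using False U Some by (simp add: trader_snoc algebra_simps)
      then have "Q t (\<lambda>x. ?Z (t @ [x])) \<le> Q t (\<lambda>x. h k (t @ [x])) + Q t (\<lambda>_. ?c)"
        by (rule coherent_add_le[OF coh])
      also have "\<dots> \<le> ereal (h k t) + ereal ?c"
        unfolding coherent_const[OF coh] by (intro add_right_mono real_supermartingaleD h)
      finally show ?thesis using U Some by (simp add: algebra_simps)
    qed
  qed
qed

lemma trader_count_mono: "fst (trader h a b m t) \<le> fst (trader h a b m (t @ [x]))"
  by (cases "trader h a b m t"; cases "snd (trader h a b m t)") (auto simp: trader_snoc trader_init)

text \<open>
  Without a further completed upcrossing the trader would keep any process it holds for ever, although that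
  process returns to level \<open>b\<close>; or it would hold nothing for ever, although processes keep being
  offered at level \<open>a\<close>.
\<close>

lemma trader_count_increases:
  assumes low: "\<And>J. \<exists>j\<ge>J. \<exists>k. h k (path_prefix j \<omega>) \<le> a"
    and high: "\<And>k J. \<exists>j\<ge>J. b \<le> h k (path_prefix j \<omega>)"
  shows "\<exists>j\<ge>J. fst (trader h a b m (path_prefix j \<omega>)) < fst (trader h a b m (path_prefix (Suc j) \<omega>))"
proof (rule ccontr)
  define S where "S j = trader h a b m (path_prefix j \<omega>)" for j
  define I where "I = max J m"
  assume "\<not> ?thesis"
  then have const: "fst (S (Suc j)) \<le> fst (S j)" if "I \<le> j" for j
    using that unfolding S_def I_def by (meson max.boundedE not_le)
  have step: "S (Suc j) = hold_step h a b (path_prefix (Suc j) \<omega>) (S j)" if "I \<le> j" for j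
    using that by (simp add: S_def I_def path_prefix_Suc trader_snoc)
  have out: "snd (S j) = None" if j: "I \<le> j" for j
  proof (rule ccontr)
    assume "snd (S j) \<noteq> None"
    then obtain U k where Sj: "S j = (U, Some k)" by (cases "S j") auto
    have stay: "S i = (U, Some k)" if "j \<le> i" for i
      using that
    proof (induction i rule: dec_induct)
      case base
      show ?case by (rule Sj)
    next
      case (step i)
      then have "I \<le> i" using j by simp
      from const[OF this] show ?case using step.IH \<open>I \<le> i\<close>
        by (auto simp: \<open>\<And>j. I \<le> j \<Longrightarrow> S (Suc j) = _\<close> split: if_splits)
    qed
    obtain i where i: "Suc j \<le> i" "b \<le> h k (path_prefix i \<omega>)" using high by blast
    then obtain i' where i': "i = Suc i'" by (cases i) auto
    have "S (Suc i') = (Suc U, None)"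
      using step[of i'] stay[of i'] i i' j by simp
    then show False using stay[of "Suc i'"] i i' by simp
  qed
  obtain i k where i: "Suc I \<le> i" "h k (path_prefix i \<omega>) \<le> a" using low by blast
  then obtain i' where i': "i = Suc i'" by (cases i) auto
  obtain U where U: "S i' = (U, None)" using out[of i'] i i' by (cases "S i'") auto
  have "snd (S (Suc i')) \<noteq> None" using step[of i'] U i i' by auto
  then show False using out[of "Suc i'"] i i' by simp
qed

lemma trader_count_unbounded:
  assumes "\<And>J. \<exists>j\<ge>J. \<exists>k. h k (path_prefix j \<omega>) \<le> a"
    and "\<And>k J. \<exists>j\<ge>J. b \<le> h k (path_prefix j \<omega>)"
  shows "filterlim (\<lambda>j. fst (trader h a b m (path_prefix j \<omega>))) at_top sequentially"
proof -
  let ?U = "\<lambda>j. fst (trader h a b m (path_prefix j \<omega>))"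
  have mono: "?U i \<le> ?U j" if "i \<le> j" for i j
    using that by (rule lift_Suc_mono_le[rotated]) (simp add: path_prefix_Suc trader_count_mono)
  have "\<exists>j. K \<le> ?U j" for K
  proof (induction K)
    case (Suc K)
    then obtain J where J: "K \<le> ?U J" by blast
    obtain j where "J \<le> j" "?U j < ?U (Suc j)" using trader_count_increases[OF assms] by blast
    then show ?case using J mono[of J j] by (intro exI[of _ "Suc j"]) simp
  qed simp
  then show ?thesis
    unfolding filterlim_at_top eventually_sequentially using mono by (meson order_trans)
qed

text \<open>
  The normalisation makes the initial capital at most \<open>1\<close> whatever the levels, so that
  countably many such processes can be combined with summable weights. For levels that are not usable the
  zero processes serve, which avoids case distinctions in an enumeration of all pairs of rationals.
\<close>

lemma upcrossing_process:
  fixes h :: "nat \<Rightarrow> 'x::finite list \<Rightarrow> real"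
  assumes Q: "imprecise_tree Q" and h: "\<And>k. real_supermartingale Q (h k)" and L: "\<And>k t. L \<le> h k t"
  obtains Y V where "real_supermartingale Q Y"
    "\<And>t. 0 \<le> V t" "\<And>t. V t \<le> Y t" "\<And>t. length t \<le> m \<Longrightarrow> Y t \<le> 1" "\<And>t x. V t \<le> V (t @ [x])"
    "\<And>\<omega>. L \<le> a \<Longrightarrow> a < b \<Longrightarrow> (\<And>J. \<exists>j\<ge>J. \<exists>k. h k (path_prefix j \<omega>) \<le> a) \<Longrightarrow>
      (\<And>k J. \<exists>j\<ge>J. b \<le> h k (path_prefix j \<omega>)) \<Longrightarrow>
      filterlim (\<lambda>j. V (path_prefix j \<omega>)) at_top sequentially"
proof (cases "L \<le> a \<and> a < b")
  case False
  show ?thesis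
    by (rule that[of "\<lambda>_. 0" "\<lambda>_. 0"]) (use False in \<open>auto simp: real_supermartingale_const[OF Q]\<close>)
next
  case True
  \<comment> \<open>A held position is worth at least \<open>L - a\<close>, so an endowment of \<open>a - L\<close> covers every loss;
    the summand 1 guards against \<open>a = L\<close>.\<close>
  define \<delta> where "\<delta> = 1 / (a - L + 1)"
  have \<delta>: "0 < \<delta>" using True by (simp add: \<delta>_def)
  define U where "U t = fst (trader h a b m t)" for t
  define Y where "Y t = \<delta> * (wealth h a b t (trader h a b m t) + (a - L))" for t
  define V where "V t = \<delta> * ((b - a) * real (U t))" for t
  show ?thesis
  proof (rule that[of Y V])
    show "real_supermartingale Q Y"
      unfolding Y_def using \<delta>
      by (intro real_supermartingale_cmult real_supermartingale_add wealth_supermartingale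
          real_supermartingale_const Q h) simp
    show "0 \<le> V t" for t using \<delta> True by (simp add: V_def)
    show "V t \<le> Y t" for t
    proof -
      have "(b - a) * real (U t) \<le> wealth h a b t (trader h a b m t) + (a - L)"
        using True L by (cases "trader h a b m t"; cases "snd (trader h a b m t)") (auto simp: U_def)
      then show ?thesis using \<delta> by (simp add: V_def Y_def)
    qed
    show "Y t \<le> 1" if "length t \<le> m" for t
      using that True by (simp add: Y_def trader_init \<delta>_def)
    show "V t \<le> V (t @ [x])" for t x
      using \<delta> True trader_count_mono[of h a b m t x] by (simp add: V_def U_def)
    show "filterlim (\<lambda>j. V (path_prefix j \<omega>)) at_top sequentially"
      if "\<And>J. \<exists>j\<ge>J. \<exists>k. h k (path_prefix j \<omega>) \<le> a" "\<And>k J. \<exists>j\<ge>J. b \<le> h k (path_prefix j \<omega>)" for \<omega>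
    proof -
      have "filterlim (\<lambda>j. real (U (path_prefix j \<omega>))) at_top sequentially"
        unfolding U_def
        by (rule filterlim_compose[OF filterlim_real_sequentially trader_count_unbounded[OF that]])
      then show ?thesis
        unfolding V_def mult.assoc[symmetric]
        by (rule filterlim_tendsto_pos_mult_at_top[OF tendsto_const, rotated]) (use \<delta> True in simp)
    qed
  qed
qed

section \<open>Fatou property of the game-theoretic upper expectation\<close>

lemma geometric_weights_le:
  assumes "0 \<le> \<epsilon>" "\<And>i. y i \<le> 1"
  shows "(\<Sum>i<N. \<epsilon> * (1/2) ^ Suc i * y i) \<le> (\<epsilon>::real)"
proof -
  have "(\<Sum>i<N. \<epsilon> * (1/2) ^ Suc i * y i) \<le> (\<Sum>i<N. \<epsilon> * (1/2) ^ Suc i)"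
    using assms by (intro sum_mono mult_left_le) auto
  also have "\<dots> = \<epsilon> * (1 - (1/2) ^ N)"
    by (induction N) (auto simp: algebra_simps)
  also have "\<dots> \<le> \<epsilon>" using assms(1) by (simp add: mult_left_le)
  finally show ?thesis .
qed

lemma V_fin_martingale:
  assumes Q: "imprecise_tree Q" and g: "g \<in> V_fin" and L: "\<And>\<omega>. ereal L \<le> g \<omega>"
  shows "\<exists>W. real_supermartingale Q W \<and> (\<forall>t. E_V Q g t = ereal (W t)) \<and> (\<forall>t. L \<le> W t) \<and>
    (\<exists>N. \<forall>\<omega>. \<forall>j\<ge>N. ereal (W (path_prefix j \<omega>)) = g \<omega>)"
proof -
  obtain N where gN: "gamble g" "n_measurable N g" using g by (auto simp: V_fin_def)
  obtain W where W: "\<And>t. Q t (\<lambda>x. W (t @ [x])) = ereal (W t)"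
    and Wg: "\<And>\<omega> j. N \<le> j \<Longrightarrow> ereal (W (path_prefix j \<omega>)) = g \<omega>"
    using finitary_martingale[OF Q gN] by metis
  have "real_supermartingale Q W" by (simp add: real_supermartingale_def W)
  then show ?thesis
    using E_V_finitary[OF Q W Wg gN(1)] martingale_lower_bound[OF Q W Wg L] Wg by blast
qed

text \<open>
  Running minima replace the convergent sequence by one that increases to the same limit, at the price of
  infima over infinitely many gambles; finite minima are still finitary.
\<close>

lemma V_fin_INF:
  fixes F :: "nat \<Rightarrow> 'x gvar"
  assumes "\<And>n. F n \<in> V_fin"
  shows "(\<lambda>\<omega>. INF i\<in>{n..n + k}. F i \<omega>) \<in> V_fin"
proof (induction k)
  case (Suc k)
  have "{n..n + Suc k} = insert (n + Suc k) {n..n + k}" by auto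
  then have "(\<lambda>\<omega>. INF i\<in>{n..n + Suc k}. F i \<omega>) =
      (\<lambda>\<omega>. min (F (n + Suc k) \<omega>) (INF i\<in>{n..n + k}. F i \<omega>))"
    by (simp add: inf_min)
  then show ?case using V_fin_min[OF assms Suc.IH] by simp
qed (simp add: assms)

lemma frequently_below_liminf:
  fixes X :: "nat \<Rightarrow> ereal"
  assumes "liminf X < a"
  shows "\<exists>j\<ge>J. X j < a"
proof (rule ccontr)
  assume "\<not> ?thesis"
  then have "a \<le> liminf X"
    by (intro Liminf_bounded) (auto simp: eventually_sequentially not_less)
  then show False using assms by simp
qed

lemma frequently_above_limsup:
  fixes X :: "nat \<Rightarrow> ereal"
  assumes "a < limsup X"
  shows "\<exists>j\<ge>J. a < X j"
proof (rule ccontr)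
  assume "\<not> ?thesis"
  then have "limsup X \<le> a"
    by (intro Limsup_bounded) (auto simp: eventually_sequentially not_less)
  then show False using assms by simp
qed

text \<open>
  The supermartingale \<open>M\<close> that certifies the inequality is the supremum over \<open>N\<close> of \<open>e N\<close>, the candidate for
  the expectation of the infimum of all \<open>F i\<close> with \<open>i \<ge> N\<close>, plus the first \<open>N\<close> weighted capitals. The traders
  are indexed by a starting point \<open>n\<close> and two rational levels, and buy among the martingales of
  the finite minima that start at \<open>n\<close>.
\<close>

lemma E_V_P5:
  fixes Q :: "('x::finite) tree"
  assumes Q: "imprecise_tree Q"
  shows "P5 (E_V Q)"
  unfolding P5_def
proof (intro allI impI, elim conjE)
  fix F :: "nat \<Rightarrow> 'x gvar" and f s
  assume F: "\<forall>n. F n \<in> V_fin" and "uniformly_bounded_below F" and lim: "pointwise_limit F f"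
  then obtain L where L: "\<And>n \<omega>. ereal L \<le> F n \<omega>" unfolding uniformly_bounded_below_def by blast
  define G where "G n k \<omega> = (INF i\<in>{n..n + k}. F i \<omega>)" for n k \<omega>
  have "G n k \<in> V_fin" for n k using V_fin_INF[of F n k] F by (simp add: G_def[abs_def])
  moreover have "ereal L \<le> G n k \<omega>" for n k \<omega> unfolding G_def by (intro INF_greatest L)
  ultimately have "\<exists>W. real_supermartingale Q W \<and> (\<forall>t. E_V Q (G n k) t = ereal (W t)) \<and>
      (\<forall>t. L \<le> W t) \<and> (\<exists>N. \<forall>\<omega>. \<forall>j\<ge>N. ereal (W (path_prefix j \<omega>)) = G n k \<omega>)" for n k
    by (rule V_fin_martingale[OF Q])
  then obtain W where W: "\<And>n k. real_supermartingale Q (W n k)"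
      "\<And>n k t. E_V Q (G n k) t = ereal (W n k t)" "\<And>n k t. L \<le> W n k t"
      "\<And>n k. \<exists>N. \<forall>\<omega>. \<forall>j\<ge>N. ereal (W n k (path_prefix j \<omega>)) = G n k \<omega>"
    by metis
  define e where "e n t = (INF k. W n k t)" for n t
  have bdd: "bdd_below (range (\<lambda>k. W n k t))" for n t by (rule bdd_belowI2[of _ L]) (rule W(3))
  have e: "real_supermartingale Q (e n)" for n
    unfolding e_def by (intro real_supermartingale_INF[OF Q W(1), of L] W(3))
  have e_le: "e n t \<le> W n k t" for n k t unfolding e_def by (intro cINF_lower bdd) simp
  have Le: "L \<le> e n t" for n t unfolding e_def by (intro cINF_greatest W(3)) simp
  \<comment> \<open>the range of indices for \<open>(n, k + 1)\<close> contains the one for \<open>(n + 1, k)\<close>\<close>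
  have e_Suc: "e n t \<le> e (Suc n) t" for n t
  proof -
    have "e n t \<le> W (Suc n) k t" for k
    proof -
      have "E_V Q (G n (Suc k)) t \<le> E_V Q (G (Suc n) k) t"
        by (rule E_V_mono) (auto simp: G_def intro!: INF_superset_mono)
      then show ?thesis using e_le[of n t "Suc k"] by (simp add: W(2))
    qed
    then show ?thesis unfolding e_def[of "Suc n"] by (intro cINF_greatest) auto
  qed
  have e_mono: "e n t \<le> e n' t" if "n \<le> n'" for n n' t
    using lift_Suc_mono_le[of "\<lambda>n. e n t", OF e_Suc that] .
  have e_limsup: "ereal (e n s) \<le> limsup (\<lambda>n. E_V Q (F n) s)" for n
  proof (rule le_Limsup)
    have "ereal (e n s) \<le> E_V Q (F j) s" if "n \<le> j" for j
    proof -
      have "ereal (e n s) \<le> ereal (W j 0 s)" using e_mono[OF that, of s] e_le[of j s 0] by simp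
      also have "\<dots> = E_V Q (F j) s" unfolding W(2)[symmetric] by (simp add: G_def[abs_def])
      finally show ?thesis .
    qed
    then show "\<forall>\<^sub>F j in sequentially. ereal (e n s) \<le> E_V Q (F j) s"
      by (auto simp: eventually_sequentially)
  qed simp
  define I where "I i = fst (from_nat i :: nat \<times> rat \<times> rat)" for i
  define A where "A i = real_of_rat (fst (snd (from_nat i :: nat \<times> rat \<times> rat)))" for i
  define B where "B i = real_of_rat (snd (snd (from_nat i :: nat \<times> rat \<times> rat)))" for i
  have "\<exists>Y V. real_supermartingale Q Y \<and> (\<forall>t. 0 \<le> V t) \<and> (\<forall>t. V t \<le> Y t) \<and>
      (\<forall>t. length t \<le> length s \<longrightarrow> Y t \<le> 1) \<and>
      (\<forall>\<omega>. L \<le> A i \<longrightarrow> A i < B i \<longrightarrow> (\<forall>J. \<exists>j\<ge>J. \<exists>k. W (I i) k (path_prefix j \<omega>) \<le> A i) \<longrightarrow>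
        (\<forall>k J. \<exists>j\<ge>J. B i \<le> W (I i) k (path_prefix j \<omega>)) \<longrightarrow>
        filterlim (\<lambda>j. V (path_prefix j \<omega>)) at_top sequentially)" for i
    by (rule upcrossing_process[OF Q, of "W (I i)" L "length s" "A i" "B i", OF W(1) W(3)]) blast
  then obtain Y V where Y: "\<And>i. real_supermartingale Q (Y i)"
    and V: "\<And>i t. 0 \<le> V i t" "\<And>i t. V i t \<le> Y i t"
    and Y1: "\<And>i t. length t \<le> length s \<Longrightarrow> Y i t \<le> 1"
    and div: "\<And>i \<omega>. L \<le> A i \<Longrightarrow> A i < B i \<Longrightarrow>
        (\<forall>J. \<exists>j\<ge>J. \<exists>k. W (I i) k (path_prefix j \<omega>) \<le> A i) \<Longrightarrow>
        (\<forall>k J. \<exists>j\<ge>J. B i \<le> W (I i) k (path_prefix j \<omega>)) \<Longrightarrow>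
        filterlim (\<lambda>j. V i (path_prefix j \<omega>)) at_top sequentially"
    by metis
  have Y0: "0 \<le> Y i t" for i t using V order_trans by blast
  show "E_V Q f s \<le> limsup (\<lambda>n. E_V Q (F n) s)"
  proof (rule ereal_le_epsilon2)
    fix \<epsilon> :: real assume \<epsilon>: "0 < \<epsilon>"
    define w where "w i = \<epsilon> * (1/2) ^ Suc i" for i
    have w: "0 < w i" for i using \<epsilon> by (simp add: w_def)
    define m where "m N t = e N t + (\<Sum>i<N. w i * Y i t)" for N t
    define M where "M t = (SUP N. ereal (m N t))" for t
    have mM: "ereal (m N t) \<le> M t" for N t unfolding M_def by (rule SUP_upper) simp
    have eM: "ereal (e N t) \<le> M t" for N t
    proof -
      have "e N t \<le> m N t" unfolding m_def using w Y0 by (simp add: sum_nonneg less_imp_le)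
      then show ?thesis using mM[of N t] by (meson ereal_less_eq(3) order_trans)
    qed
    have "E_V Q f s \<le> M s"
    proof (rule E_V_le)
      show "supermartingale Q M"
        unfolding M_def
      proof (rule supermartingale_SUP[OF Q])
        show "real_supermartingale Q (m N)" for N
          unfolding m_def using w
          by (intro real_supermartingale_add real_supermartingale_sum real_supermartingale_cmult Q e Y)
            (simp add: less_imp_le)
        show "m N t \<le> m (Suc N) t" for N t
          unfolding m_def using w[of N] Y0[of N t] e_Suc[of N t] by (simp add: add_increasing2)
      qed
      show "bounded_below M"
        unfolding bounded_below_def using eM Le by (meson ereal_less_eq(3) order_trans)
      fix \<omega> :: "'x path"
      show "f \<omega> \<le> liminf (\<lambda>j. M (path_prefix j \<omega>))"
      proof (rule ccontr)
        assume "\<not> ?thesis"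
        then have "liminf (\<lambda>j. M (path_prefix j \<omega>)) < f \<omega>" by simp
        then obtain a where a: "liminf (\<lambda>j. M (path_prefix j \<omega>)) < ereal (real_of_rat a)"
            "ereal (real_of_rat a) < f \<omega>"
          using ereal_dense3 by blast
        then obtain b where b: "ereal (real_of_rat a) < ereal (real_of_rat b)"
            "ereal (real_of_rat b) < f \<omega>"
          using ereal_dense3 by blast
        obtain n where n: "\<And>k. n \<le> k \<Longrightarrow> ereal (real_of_rat b) < F k \<omega>"
          using order_tendstoD(1)[OF lim[unfolded pointwise_limit_def, rule_format] b(2)]
          by (auto simp: eventually_sequentially)
        \<comment> \<open>This trader finds an offer below \<open>a\<close> whenever \<open>e n < a\<close>, and each process it buys ends at
          the value of a minimum of \<open>F k\<close> with \<open>k \<ge> n\<close>, which exceeds \<open>b\<close>.\<close>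
        define i where "i = to_nat (n, a, b)"
        have i: "I i = n" "A i = real_of_rat a" "B i = real_of_rat b"
          by (simp_all add: I_def A_def B_def i_def)
        note below = frequently_below_liminf[OF a(1)]
        have e_low: "e n (path_prefix j \<omega>) < A i" if "M (path_prefix j \<omega>) < ereal (real_of_rat a)" for j
          using order_le_less_trans[OF eM that, of n] by (simp add: i)
        have "filterlim (\<lambda>j. V i (path_prefix j \<omega>)) at_top sequentially"
        proof (rule div)
          show "L \<le> A i" using below[of 0] e_low Le by (meson less_imp_le order_le_less_trans)
          show "A i < B i" using b by (simp add: i)
          show "\<forall>J. \<exists>j\<ge>J. \<exists>k. W (I i) k (path_prefix j \<omega>) \<le> A i"
          proof
            fix J
            obtain j where j: "J \<le> j" "M (path_prefix j \<omega>) < ereal (real_of_rat a)" using below by blast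
            have "\<exists>k. W n k (path_prefix j \<omega>) \<le> A i"
            proof (rule ccontr)
              assume "\<not> ?thesis"
              then have "A i \<le> e n (path_prefix j \<omega>)"
                unfolding e_def by (intro cINF_greatest) (auto simp: not_le less_imp_le)
              then show False using e_low[OF j(2)] by simp
            qed
            then show "\<exists>j\<ge>J. \<exists>k. W (I i) k (path_prefix j \<omega>) \<le> A i" using j(1) i(1) by blast
          qed
          show "\<forall>k J. \<exists>j\<ge>J. B i \<le> W (I i) k (path_prefix j \<omega>)"
          proof (intro allI)
            fix k J
            obtain N where N: "\<And>\<omega> j. N \<le> j \<Longrightarrow> ereal (W n k (path_prefix j \<omega>)) = G n k \<omega>"
              using W(4) by blast
            have "ereal (B i) \<le> G n k \<omega>"
              unfolding G_def i by (intro INF_greatest less_imp_le[OF n]) simp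
            then have "B i \<le> W n k (path_prefix (max J N) \<omega>)"
              using N[of "max J N" \<omega>] by (metis ereal_less_eq(3) max.cobounded2)
            then show "\<exists>j\<ge>J. B i \<le> W (I i) k (path_prefix j \<omega>)"
              unfolding i(1) by (intro exI[of _ "max J N"]) simp
          qed
        qed
        then obtain J where J: "\<And>j. J \<le> j \<Longrightarrow> (A i - L) / w i \<le> V i (path_prefix j \<omega>)"
          unfolding filterlim_at_top eventually_sequentially by blast
        obtain j where j: "J \<le> j" "M (path_prefix j \<omega>) < ereal (real_of_rat a)" using below by blast
        let ?t = "path_prefix j \<omega>"
        have "A i - L \<le> w i * V i ?t" using J[OF j(1)] w[of i] by (simp add: field_simps)
        also have "\<dots> \<le> w i * Y i ?t" using w[of i] V(2) by simp
        also have "\<dots> \<le> (\<Sum>i<Suc i. w i * Y i ?t)"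
          using w Y0 by (intro member_le_sum) (auto simp: less_imp_le)
        finally have "A i \<le> m (Suc i) ?t" using Le[of "Suc i" ?t] by (simp add: m_def)
        then have "ereal (A i) \<le> M ?t" using mM[of "Suc i" ?t] by (meson ereal_less_eq(3) order_trans)
        then show False using j(2) i by simp
      qed
    qed
    also have "M s \<le> limsup (\<lambda>n. E_V Q (F n) s) + ereal \<epsilon>"
      unfolding M_def
    proof (rule SUP_least)
      fix N
      have "ereal (m N s) = ereal (e N s) + ereal (\<Sum>i<N. w i * Y i s)" by (simp add: m_def)
      also have "\<dots> \<le> limsup (\<lambda>n. E_V Q (F n) s) + ereal \<epsilon>"
        unfolding w_def using geometric_weights_le[of \<epsilon> "\<lambda>i. Y i s" N] \<epsilon> Y1[of s]
        by (intro add_mono e_limsup) simp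
      finally show "ereal (m N s) \<le> limsup (\<lambda>n. E_V Q (F n) s) + ereal \<epsilon>" .
    qed
    finally show "E_V Q f s \<le> limsup (\<lambda>n. E_V Q (F n) s) + ereal \<epsilon>" .
  qed
qed


section \<open>Every upper expectation satisfying the axioms is dominated\<close>

lemma real_supermartingale_stopped:
  assumes Q: "imprecise_tree Q" and m: "real_supermartingale Q m"
  shows "real_supermartingale Q (\<lambda>t. m (take n t))"
  unfolding real_supermartingale_def
proof
  fix t
  show "Q t (\<lambda>x. m (take n (t @ [x]))) \<le> ereal (m (take n t))"
    using real_supermartingaleD[OF m, of t] coherent_const[OF tree_coherent[OF Q], of t]
    by (cases "length t < n") simp_all
qed

text \<open>
  A supermartingale only has to dominate a gamble at a fixed time \<open>n\<close>: it can be stopped then.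
\<close>

lemma E_V_le_real_supermartingale:
  assumes Q: "imprecise_tree Q" and m: "real_supermartingale Q m" and L: "\<And>t. L \<le> m t"
    and n: "length s \<le> n" and g: "\<And>\<omega>. \<omega> \<in> cylinder s \<Longrightarrow> g \<omega> \<le> ereal (m (path_prefix n \<omega>))"
  shows "E_V Q g s \<le> ereal (m s)"
proof -
  have "E_V Q g s \<le> ereal (m (take n s))"
  proof (rule E_V_le)
    show "supermartingale Q (\<lambda>t. ereal (m (take n t)))"
      by (simp add: real_supermartingale_supermartingale[OF Q] real_supermartingale_stopped[OF Q m])
    show "bounded_below (\<lambda>t. ereal (m (take n t)))"
      using L by (auto simp: bounded_below_def)
    fix \<omega> assume "\<omega> \<in> cylinder s"
    have "liminf (\<lambda>j. ereal (m (take n (path_prefix j \<omega>)))) = ereal (m (path_prefix n \<omega>))"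
      by (rule liminf_eventually_const[of n]) (simp add: take_path_prefix min_absorb1)
    then show "g \<omega> \<le> liminf (\<lambda>j. ereal (m (take n (path_prefix j \<omega>))))"
      using g[OF \<open>\<omega> \<in> cylinder s\<close>] by simp
  qed
  then show ?thesis using n by simp
qed

text \<open>
  Given an admissible \<open>M\<close>, P5 has to be applied to finitary gambles \<open>G j\<close> that converge everywhere to a limit
  above \<open>f\<close>, although \<open>M\<close> itself need not converge. Truncating \<open>M\<close> at time \<open>n\<close> by \<open>n\<close> makes them real without
  affecting the limit, and the nondecreasing processes \<open>V i\<close> force divergence to infinity wherever
  \<open>M\<close> oscillates.
\<close>

lemma expectation_le_E_V:
  fixes Q :: "('x::finite) tree"
  assumes Q: "imprecise_tree Q" and E: "E \<in> E15 Q"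
  shows "E f s \<le> E_V Q f s"
proof (rule E_V_ge)
  have ax: "P1 Q E" "P2 E" "P3 E" "P4 E" "P5 E" using E by (simp_all add: E15_def)
  fix M assume M: "supermartingale Q M" and bb: "bounded_below M"
    and lim: "\<And>\<omega>. \<omega> \<in> cylinder s \<Longrightarrow> f \<omega> \<le> liminf (\<lambda>n. M (path_prefix n \<omega>))"
  obtain L where L: "\<And>t. ereal L \<le> M t" using bb unfolding bounded_below_def by blast
  define h where "h c t = real_of_ereal (min (M t) (ereal c))" for c t
  have h: "ereal (h c t) = min (M t) (ereal c)" for c t
    unfolding h_def by (rule real_min_ereal[OF L])
  have h_super: "real_supermartingale Q (h c)" for c
    unfolding h_def by (rule supermartingale_truncate[OF Q M L])
  have h_ge: "min L c \<le> h c t" for c t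
  proof -
    have "ereal (min L c) \<le> ereal (h c t)" unfolding h using L[of t] by (simp add: min.coboundedI1 min.coboundedI2)
    then show ?thesis unfolding ereal_less_eq(3) .
  qed
  define A where "A i = real_of_rat (fst (from_nat i :: rat \<times> rat))" for i
  define B where "B i = real_of_rat (snd (from_nat i :: rat \<times> rat))" for i
  \<comment> \<open>There is only one process to hold here, \<open>M\<close> truncated at the upper level \<open>b\<close>; it crosses
    \<open>[a, b]\<close> exactly when \<open>M\<close> does.\<close>
  have "\<exists>Y V. real_supermartingale Q Y \<and> (\<forall>t. 0 \<le> V t) \<and> (\<forall>t. V t \<le> Y t) \<and>
      (\<forall>t. length t \<le> length s \<longrightarrow> Y t \<le> 1) \<and> (\<forall>t x. V t \<le> V (t @ [x])) \<and>
      (\<forall>\<omega>. min L (B i) \<le> A i \<longrightarrow> A i < B i \<longrightarrow> (\<forall>J. \<exists>j\<ge>J. \<exists>k::nat. h (B i) (path_prefix j \<omega>) \<le> A i) \<longrightarrow>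
        (\<forall>(k::nat) J. \<exists>j\<ge>J. B i \<le> h (B i) (path_prefix j \<omega>)) \<longrightarrow>
        filterlim (\<lambda>j. V (path_prefix j \<omega>)) at_top sequentially)" for i
    by (rule upcrossing_process[OF Q, of "\<lambda>_. h (B i)" "min L (B i)" "length s" "A i" "B i", OF h_super h_ge]) blast
  then obtain Y V where Y: "\<And>i. real_supermartingale Q (Y i)"
    and V: "\<And>i t. 0 \<le> V i t" "\<And>i t. V i t \<le> Y i t"
    and Y1: "\<And>i t. length t \<le> length s \<Longrightarrow> Y i t \<le> 1"
    and V_mono: "\<And>i t x. V i t \<le> V i (t @ [x])"
    and div: "\<And>i \<omega>. min L (B i) \<le> A i \<Longrightarrow> A i < B i \<Longrightarrow>
        (\<forall>J. \<exists>j\<ge>J. \<exists>k::nat. h (B i) (path_prefix j \<omega>) \<le> A i) \<Longrightarrow>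
        (\<forall>(k::nat) J. \<exists>j\<ge>J. B i \<le> h (B i) (path_prefix j \<omega>)) \<Longrightarrow>
        filterlim (\<lambda>j. V i (path_prefix j \<omega>)) at_top sequentially"
    by metis
  have Y0: "0 \<le> Y i t" for i t using V order_trans by blast
  show "E f s \<le> M s"
  proof (rule ereal_le_epsilon2)
    fix \<epsilon> :: real assume \<epsilon>: "0 < \<epsilon>"
    define w where "w i = \<epsilon> * (1/2) ^ Suc i" for i
    have w: "0 < w i" for i using \<epsilon> by (simp add: w_def)
    define \<phi> where "\<phi> n t = (\<Sum>i<n. w i * V i t)" for n t
    define T where "T n t = h (real n) t + (\<Sum>i<n. w i * Y i t)" for n t
    define a where "a n t = h (real n) t + \<phi> n t" for n t
    have \<phi>0: "0 \<le> \<phi> n t" for n t unfolding \<phi>_def using w V(1) by (intro sum_nonneg) (simp add: less_imp_le)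
    have a_le_T: "a n t \<le> T n t" for n t
      unfolding a_def T_def \<phi>_def using w V(2) by (intro add_left_mono sum_mono mult_left_mono) (simp_all add: less_imp_le)
    have a_ge: "min L 0 \<le> a n t" for n t
      using h_ge[of "real n" t] \<phi>0[of n t] by (simp add: a_def)
    have T_super: "real_supermartingale Q (T n)" for n
      unfolding T_def using w
      by (intro real_supermartingale_add real_supermartingale_sum real_supermartingale_cmult Q h_super Y)
        (simp add: less_imp_le)
    \<comment> \<open>Off the cylinder of \<open>s\<close> the values tend to infinity, so that the limit dominates \<open>f\<close> there too, while
      the expectation in \<open>s\<close> does not depend on them. The shift by \<open>length s\<close> makes membership in the
      cylinder visible at time \<open>length s + j\<close>.\<close>
    define G where "G j \<omega> = ereal ((\<lambda>t. if take (length s) t = s then a (length s + j) t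
        else real (length s + j)) (path_prefix (length s + j) \<omega>))" for j \<omega>
    have take_s: "take (length s) (path_prefix (length s + j) \<omega>) = s \<longleftrightarrow> \<omega> \<in> cylinder s" for j \<omega>
      by (simp add: take_path_prefix cylinder_iff)
    have G_in: "G j \<omega> = ereal (a (length s + j) (path_prefix (length s + j) \<omega>))" if "\<omega> \<in> cylinder s" for j \<omega>
      using that by (simp add: G_def take_s)
    have G_out: "G j \<omega> = ereal (real (length s + j))" if "\<omega> \<notin> cylinder s" for j \<omega>
      using that by (simp add: G_def take_s)
    have G_fin: "G j \<in> V_fin" for j
      unfolding G_def[abs_def] by (rule prefix_function_finitary(3))
    have "ereal (min L 0) \<le> G j \<omega>" for j \<omega>
      unfolding G_def ereal_less_eq(3) using a_ge by (simp add: min.coboundedI2)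
    then have G_below: "uniformly_bounded_below G" unfolding uniformly_bounded_below_def by blast
    have E_G: "E (G j) s \<le> M s + ereal \<epsilon>" for j
    proof -
      let ?n = "length s + j"
      have "E (G j) s \<le> E_V Q (G j) s"
        by (rule expectation_finitary_le_E_V[OF Q ax(1-4) G_fin])
      also have "\<dots> \<le> ereal (T ?n s)"
      proof (rule E_V_le_real_supermartingale[OF Q T_super, of "min L 0" _ _ ?n])
        show "min L 0 \<le> T ?n t" for t using a_ge a_le_T order_trans by blast
        show "G j \<omega> \<le> ereal (T ?n (path_prefix ?n \<omega>))" if "\<omega> \<in> cylinder s" for \<omega>
          using a_le_T by (simp add: G_in[OF that])
      qed simp
      also have "\<dots> = ereal (h ?n s) + ereal (\<Sum>i<?n. w i * Y i s)" by (simp add: T_def)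
      also have "\<dots> \<le> M s + ereal \<epsilon>"
        unfolding w_def h using geometric_weights_le[of \<epsilon> "\<lambda>i. Y i s" ?n] \<epsilon> Y1[of s]
        by (intro add_mono) simp_all
      finally show ?thesis .
    qed
    have limit: "\<exists>l. (\<lambda>j. G j \<omega>) \<longlonglongrightarrow> l \<and> f \<omega> \<le> l" for \<omega>
    proof (cases "\<omega> \<in> cylinder s")
      case False
      have "filterlim (\<lambda>j. real (length s + j)) at_top sequentially"
        unfolding of_nat_add by (rule filterlim_tendsto_add_at_top[OF tendsto_const filterlim_real_sequentially])
      then have "(\<lambda>j. G j \<omega>) \<longlonglongrightarrow> \<infinity>"
        unfolding G_out[OF False] tendsto_PInfty_eq_at_top .
      then show ?thesis by (intro exI[of _ \<infinity>]) simp
    next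
      case True
      define X where "X n = M (path_prefix n \<omega>)" for n
      have fX: "f \<omega> \<le> liminf X" using lim[OF True] by (simp add: X_def[abs_def])
      have LX: "ereal L \<le> liminf X" by (rule Liminf_bounded) (simp add: X_def L)
      have "\<exists>l. (\<lambda>n. ereal (a n (path_prefix n \<omega>))) \<longlonglongrightarrow> l \<and> f \<omega> \<le> l"
      proof (cases "liminf X = limsup X")
        case True
        then have X: "X \<longlonglongrightarrow> liminf X"
          by (simp add: tendsto_iff_Liminf_eq_Limsup)
        have "(\<lambda>n. min (X n) (ereal (real n))) \<longlonglongrightarrow> min (liminf X) \<infinity>"
          by (intro tendsto_min X) (simp add: tendsto_PInfty_eq_at_top filterlim_real_sequentially)
        then have 1: "(\<lambda>n. ereal (h (real n) (path_prefix n \<omega>))) \<longlonglongrightarrow> liminf X"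
          by (simp add: h X_def)
        have "incseq (\<lambda>n. \<phi> n (path_prefix n \<omega>))"
        proof (rule incseq_SucI)
          fix n
          have "\<phi> n (path_prefix n \<omega>) \<le> (\<Sum>i<n. w i * V i (path_prefix (Suc n) \<omega>))"
            unfolding \<phi>_def path_prefix_Suc using w V_mono
            by (intro sum_mono mult_left_mono) (simp_all add: less_imp_le)
          also have "\<dots> \<le> \<phi> (Suc n) (path_prefix (Suc n) \<omega>)"
            unfolding \<phi>_def using w[of n] V(1)[of n "path_prefix (Suc n) \<omega>"] by simp
          finally show "\<phi> n (path_prefix n \<omega>) \<le> \<phi> (Suc n) (path_prefix (Suc n) \<omega>)" .
        qed
        then have "incseq (\<lambda>n. ereal (\<phi> n (path_prefix n \<omega>)))" by (simp add: incseq_def)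
        then have 2: "(\<lambda>n. ereal (\<phi> n (path_prefix n \<omega>))) \<longlonglongrightarrow> (SUP n. ereal (\<phi> n (path_prefix n \<omega>)))"
          by (rule LIMSEQ_SUP)
        have 3: "0 \<le> (SUP n. ereal (\<phi> n (path_prefix n \<omega>)))"
          by (rule SUP_upper2[of 0]) (simp_all add: \<phi>0)
        have "(\<lambda>n. ereal (h (real n) (path_prefix n \<omega>)) + ereal (\<phi> n (path_prefix n \<omega>)))
            \<longlonglongrightarrow> liminf X + (SUP n. ereal (\<phi> n (path_prefix n \<omega>)))"
          by (rule tendsto_add_ereal_nonneg[OF _ _ 1 2]) (use LX 3 in auto)
        moreover have "f \<omega> \<le> liminf X + (SUP n. ereal (\<phi> n (path_prefix n \<omega>)))"
          using add_mono[OF fX 3] by simp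
        ultimately show ?thesis unfolding a_def by auto
      next
        case False
        then have "liminf X < limsup X" using Liminf_le_Limsup[of sequentially X] by simp
        then obtain p where p: "liminf X < ereal (real_of_rat p)" "ereal (real_of_rat p) < limsup X"
          using ereal_dense3 by blast
        then obtain q where q: "ereal (real_of_rat p) < ereal (real_of_rat q)" "ereal (real_of_rat q) < limsup X"
          using ereal_dense3 by blast
        define i where "i = to_nat (p, q)"
        have i: "A i = real_of_rat p" "B i = real_of_rat q"
          by (simp_all add: A_def B_def i_def)
        have div': "filterlim (\<lambda>j. V i (path_prefix j \<omega>)) at_top sequentially"
        proof (rule div)
          have "ereal L < ereal (real_of_rat p)" using LX p(1) by (rule order_le_less_trans)
          then show "min L (B i) \<le> A i" by (simp add: i)
          show "A i < B i" using q(1) by (simp add: i)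
          show "\<forall>J. \<exists>j\<ge>J. \<exists>k::nat. h (B i) (path_prefix j \<omega>) \<le> A i"
          proof
            fix J
            obtain j where j: "J \<le> j" "X j < ereal (real_of_rat p)"
              using frequently_below_liminf[OF p(1)] by blast
            have "ereal (h (B i) (path_prefix j \<omega>)) \<le> ereal (A i)"
              unfolding h using j(2) by (simp add: X_def i min.coboundedI1 less_imp_le)
            then show "\<exists>j\<ge>J. \<exists>k::nat. h (B i) (path_prefix j \<omega>) \<le> A i" using j(1) by auto
          qed
          show "\<forall>(k::nat) J. \<exists>j\<ge>J. B i \<le> h (B i) (path_prefix j \<omega>)"
          proof (intro allI)
            fix J
            obtain j where j: "J \<le> j" "ereal (real_of_rat q) < X j"
              using frequently_above_limsup[OF q(2)] by blast
            have "ereal (B i) \<le> ereal (h (B i) (path_prefix j \<omega>))"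
              unfolding h using j(2) by (simp add: X_def i less_imp_le)
            then show "\<exists>j\<ge>J. B i \<le> h (B i) (path_prefix j \<omega>)" using j(1) by auto
          qed
        qed
        have "filterlim (\<lambda>n. min L 0 + w i * V i (path_prefix n \<omega>)) at_top sequentially"
          by (intro filterlim_tendsto_add_at_top[OF tendsto_const]
              filterlim_tendsto_pos_mult_at_top[OF tendsto_const w div'])
        then have "filterlim (\<lambda>n. a n (path_prefix n \<omega>)) at_top sequentially"
        proof (rule filterlim_at_top_mono)
          show "\<forall>\<^sub>F n in sequentially. min L 0 + w i * V i (path_prefix n \<omega>) \<le> a n (path_prefix n \<omega>)"
            unfolding eventually_sequentially
          proof (intro exI allI impI)
            fix n assume n: "Suc i \<le> n"
            have "w i * V i (path_prefix n \<omega>) \<le> \<phi> n (path_prefix n \<omega>)"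
              unfolding \<phi>_def using n w V(1) by (intro member_le_sum) (auto simp: less_imp_le)
            then show "min L 0 + w i * V i (path_prefix n \<omega>) \<le> a n (path_prefix n \<omega>)"
              using h_ge[of "real n" "path_prefix n \<omega>"] by (simp add: a_def)
          qed
        qed
        then show ?thesis
          by (intro exI[of _ \<infinity>]) (simp add: tendsto_PInfty_eq_at_top)
      qed
      then obtain l where l: "(\<lambda>n. ereal (a n (path_prefix n \<omega>))) \<longlonglongrightarrow> l" "f \<omega> \<le> l" by blast
      have "(\<lambda>j. G j \<omega>) \<longlonglongrightarrow> l"
        using LIMSEQ_ignore_initial_segment[OF l(1), of "length s"]
        by (simp add: G_in[OF True] add.commute)
      then show ?thesis using l(2) by blast
    qed
    then obtain g where g: "\<And>\<omega>. (\<lambda>j. G j \<omega>) \<longlonglongrightarrow> g \<omega>" "\<And>\<omega>. f \<omega> \<le> g \<omega>" by metis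
    have "E f s \<le> E g s" using ax(4) g(2) unfolding P4_def by blast
    also have "\<dots> \<le> limsup (\<lambda>j. E (G j) s)"
      using ax(5) G_fin G_below g(1) unfolding P5_def pointwise_limit_def by blast
    also have "\<dots> \<le> M s + ereal \<epsilon>" by (intro Limsup_bounded always_eventually allI E_G)
    finally show "E f s \<le> M s + ereal \<epsilon>" .
  qed
qed

section \<open>Characterisation of the most conservative upper expectation\<close>

lemma E_V_most_conservative:
  assumes Q: "imprecise_tree Q"
  shows "most_conservative (E15 Q) (E_V Q)"
proof -
  have "P3 (E_V Q)" 
    unfolding P3_def by (intro ballI allI eq_refl) (rule E_V_P3_eq[OF Q, unfolded P3_eq_def, rule_format])
  then have "E_V Q \<in> E15 Q"
    by (simp add: E15_def E_V_P1[OF Q] E_V_P2 E_V_P4 E_V_P5[OF Q])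
  then show ?thesis unfolding most_conservative_def using expectation_le_E_V[OF Q] by blast
qed

lemma most_conservative_unique:
  "most_conservative \<E> E \<Longrightarrow> most_conservative \<E> E' \<Longrightarrow> E = E'"
  unfolding most_conservative_def by (intro ext antisym) blast+

text \<open>
  The sequence that P6 provides for \<open>g\<close> is used in P5 for \<open>E_V\<close>; the two expectations agree along it because
  it consists of finitary gambles.
\<close>

lemma E_V_le_expectation:
  assumes Q: "imprecise_tree Q" and E: "E \<in> E15 Q" "P3_eq E" "P6 E" "P7 E"
  shows "E_V Q f s \<le> E f s"
proof -
  have ax: "P1 Q E" "P2 E" using E(1) by (simp_all add: E15_def)
  have blim: "E_V Q g s \<le> E g s" if g: "g \<in> V_blim" for g
  proof -
    obtain F where F: "\<And>n. gamble (F n) \<and> n_measurable n (F n)" "uniformly_bounded_below F"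
        "pointwise_limit F g" "limsup (\<lambda>n. E (F n) s) \<le> E g s"
      using E(3) g unfolding P6_def by blast
    have F_fin: "F n \<in> V_fin" for n using F(1) by (auto simp: V_fin_def)
    have "E_V Q g s \<le> limsup (\<lambda>n. E_V Q (F n) s)"
      using E_V_P5[OF Q] F_fin F(2,3) unfolding P5_def by blast
    also have "\<dots> = limsup (\<lambda>n. E (F n) s)"
      by (simp add: expectation_finitary_eq_E_V[OF Q ax E(2) F_fin])
    finally show ?thesis using F(4) by (rule order_trans)
  qed
  have "E_V Q f s \<le> Inf {E g s |g. g \<in> V_blim \<and> (\<forall>\<omega>. f \<omega> \<le> g \<omega>)}"
  proof (rule Inf_greatest, clarify)
    fix g assume g: "g \<in> V_blim" "\<forall>\<omega>. f \<omega> \<le> g \<omega>"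
    have "E_V Q f s \<le> E_V Q g s" using g(2) by (intro E_V_mono) simp
    also have "\<dots> \<le> E g s" by (rule blim[OF g(1)])
    finally show "E_V Q f s \<le> E g s" .
  qed
  also have "\<dots> = E f s" by (rule E(4)[unfolded P7_def, THEN spec, THEN spec, symmetric])
  finally show ?thesis .
qed

theorem theorem6:
  fixes Q :: "('x::finite) tree"
  assumes "imprecise_tree Q"
  shows "(\<exists>!E_A. most_conservative (E15 Q) E_A) \<and>
    most_conservative (E15 Q) (E_V Q) \<and>
    (\<forall>E\<in>E15 Q. P3_eq E \<and> P6 E \<and> P7 E \<longrightarrow>
       most_conservative (E15 Q) E \<and> E = E_V Q)"
proof (intro conjI ballI impI)
  note E_V = E_V_most_conservative[OF assms]
  show "\<exists>!E_A. most_conservative (E15 Q) E_A"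
    using E_V most_conservative_unique by blast
  show "most_conservative (E15 Q) (E_V Q)" by (rule E_V)
  fix E assume E: "E \<in> E15 Q" "P3_eq E \<and> P6 E \<and> P7 E"
  show "E = E_V Q"
    using E by (intro ext antisym expectation_le_E_V E_V_le_expectation assms) simp_all
  then show "most_conservative (E15 Q) E" using E_V by simp
qed

end
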